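(* Let $G=\mathbb{R}^n$ be a stratified nilpotent Lie group of rank $r$, identified with $\mathbb{R}^n$ via exponential coordinates of the second type induced by an adapted basis $X_1,\dots,X_n$ of its Lie algebra, with structure constants $c_{ij}^k$ and extremal polynomials $P_i^v$, $i=1,\dots,n$, $v\in\mathbb{R}^n$. Let $\gamma:[0,1]\to G$ be a horizontal curve such that $\gamma(0)=0$, and let $\lambda_1,\dots,\lambda_n:[0,1]\to\mathbb{R}$ be Lipschitz functions. The following statements are equivalent: (A) The functions $\lambda_1,\dots,\lambda_n$ solve the system of equations $$\dot\lambda_i=-\sum_{k=1}^n\sum_{j=1}^r c_{ij}^k\,\dot\gamma_j\,\lambda_k\quad\text{a.e. on }[0,1],\qquad i=1,\dots,n.$$ (B) There exists $v\in\mathbb{R}^n$ such that, for all $i=1,\dots,n$, we have $\lambda_i(t)=P_i^v(\gamma(t))$ for all $t\in[0,1]$; and in fact $v=(\lambda_1(0),\dots,\lambda_n(0))$.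
   Context: Stratified group. $G$ is a (connected, simply connected) nilpotent Lie group of dimension $n$ whose real Lie algebra of left-invariant vector fields is stratified: $\mathfrak g=\mathfrak g_1\oplus\cdots\oplus\mathfrak g_s$, $\mathfrak g_i=[\mathfrak g_{i-1},\mathfrak g_1]$ for $i=2,\dots,s$, $\mathfrak g_i=\{0\}$ for $i>s$; $r=\dim\mathfrak g_1$ is the rank. $X_1,\dots,X_n$ is a basis of $\mathfrak g$ adapted to the stratification: each $X_j$ lies in some $\mathfrak g_k$, in which case its degree is $d(j)=k$, and $i<j$ implies $d(i)\le d(j)$; so $X_1,\dots,X_r$ is a basis of $\mathfrak g_1$. Structure constants: $[X_i,X_j]=\sum_{k=1}^nc_{ij}^kX_k$. Coordinates. $G$ is identified with $\mathbb{R}^n$ by $x=(x_1,\dots,x_n)\leftrightarrow \exp(x_nX_n)\cdot\ldots\cdot\exp(x_1X_1)$, and $X_1,\dots,X_n$ are viewed as left-invariant vector fields on $\mathbb{R}^n$. Extremal polynomials (for indices $1,\dots,n$). For $\alpha\in\mathbb{N}^n=\{0,1,2,\dots\}^n$ and $i=1,\dots,n$, $[X_i,X_\alpha]$ denotes the left-nested iterated bracket in which, starting from $X_i$, one brackets on the right $\alpha_1$ times with $X_1$, then $\alpha_2$ times with $X_2$, ..., finally $\alpha_n$ times with $X_n$; $[X_i,X_0]=X_i$. The constants $c_{i\alpha}^k$ are defined by $[X_i,X_\alpha]=\sum_{k=1}^nc_{i\alpha}^kX_k$. For $v=(v_1,\dots,v_n)\in\mathbb{R}^n$, $$P_i^v(x)=\sum_{\alpha\in\mathbb{N}^n}\frac{(-1)^{|\alpha|}}{\alpha!}\Big(\sum_{k=1}^nc_{i\alpha}^kv_k\Big)x^\alpha,\qquad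 x\in\mathbb{R}^n,$$ where $|\alpha|=\alpha_1+\cdots+\alpha_n$, $\alpha!=\alpha_1!\cdots\alpha_n!$ (only finitely many terms are nonzero). Horizontal curves. A Lipschitz curve $\gamma=(\gamma_1,\dots,\gamma_n):[0,1]\to G=\mathbb{R}^n$ is horizontal if there is $h=(h_1,\dots,h_r)\in L^\infty([0,1];\mathbb{R}^r)$ with $\dot\gamma=\sum_{j=1}^rh_jX_j(\gamma)$ a.e. on $[0,1]$; then $h_j=\dot\gamma_j$ for $j=1,\dots,r$. *)

theory Defs
  imports "HOL-Analysis.Analysis" "HOL-Library.Function_Algebras"
begin

text \<open>Vector fields are functions; the pointwise vector space structure gives access to
  \<^const>\<open>span\<close>, \<^const>\<open>independent\<close>, \<^const>\<open>dim\<close> and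
  \<^const>\<open>representation\<close> for them.\<close>

instantiation "fun" :: (type, real_vector) real_vector
begin

definition scaleR_fun :: "real \<Rightarrow> ('a \<Rightarrow> 'b) \<Rightarrow> 'a \<Rightarrow> 'b"
  where "scaleR_fun c f = (\<lambda>x. c *\<^sub>R f x)"

instance
  by standard (simp_all add: scaleR_fun_def fun_eq_iff algebra_simps)

end

subsection \<open>Smooth maps and vector fields\<close>

text \<open>All iterated directional derivatives exist up to order \<open>k\<close> and are continuous.\<close>

fun Ck :: "nat \<Rightarrow> ('a::euclidean_space \<Rightarrow> 'b::euclidean_space) \<Rightarrow> bool" where
  "Ck 0 f \<longleftrightarrow> continuous_on UNIV f"
| "Ck (Suc k) f \<longleftrightarrow>
     (\<forall>x. f differentiable (at x)) \<and> (\<forall>v. Ck k (\<lambda>x. frechet_derivative f (at x) v))"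

definition smooth :: "('a::euclidean_space \<Rightarrow> 'b::euclidean_space) \<Rightarrow> bool"
  where "smooth f \<longleftrightarrow> (\<forall>k. Ck k f)"

type_synonym 'n pt = "real^'n"
type_synonym 'n vfield = "'n pt \<Rightarrow> 'n pt"

text \<open>With vector fields read as derivations, this is \<open>[Y,Z] f = Y (Z f) - Z (Y f)\<close>.\<close>

definition lie_bracket :: "'n::finite vfield \<Rightarrow> 'n vfield \<Rightarrow> 'n vfield"
  where "lie_bracket Y Z =
    (\<lambda>x. frechet_derivative Z (at x) (Y x) - frechet_derivative Y (at x) (Z x))"

definition bracket_span :: "'n::finite vfield set \<Rightarrow> 'n vfield set \<Rightarrow> 'n vfield set"
  where "bracket_span A B = span {lie_bracket Y Z |Y Z. Y \<in> A \<and> Z \<in> B}"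

subsection \<open>Stratified groups\<close>

text \<open>A Lie group with underlying manifold \<open>\<real>\<^sup>n\<close> whose identity is the origin.\<close>

definition lie_group ::
    "('n::finite pt \<Rightarrow> 'n pt \<Rightarrow> 'n pt) \<Rightarrow> ('n pt \<Rightarrow> 'n pt) \<Rightarrow> bool"
  where "lie_group mul iv \<longleftrightarrow>
    group mul 0 iv \<and> smooth (\<lambda>p. mul (fst p) (snd p)) \<and> smooth iv"

definition lie_algebra :: "('n::finite pt \<Rightarrow> 'n pt \<Rightarrow> 'n pt) \<Rightarrow> 'n vfield set"
  where "lie_algebra mul =
    {Y. smooth Y \<and> (\<forall>x y. Y (mul x y) = frechet_derivative (mul x) (at y) (Y y))}"

text \<open>The layers are \<open>g 1, \<dots>, g s\<close>; the value \<open>g 0\<close> is irrelevant. The generation condition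
  is imposed for all \<open>i \<ge> 2\<close>, so that in particular \<open>[g s, g 1] = {0}\<close>, and the Lie algebra
  is nilpotent.\<close>

definition stratification ::
    "('n::finite pt \<Rightarrow> 'n pt \<Rightarrow> 'n pt) \<Rightarrow> nat \<Rightarrow> (nat \<Rightarrow> 'n vfield set) \<Rightarrow> bool"
  where "stratification mul s g \<longleftrightarrow>
    (\<forall>i\<in>{1..s}. subspace (g i) \<and> g i \<subseteq> lie_algebra mul) \<and>
    (\<forall>Y\<in>lie_algebra mul. \<exists>!f. (\<forall>i\<in>{1..s}. f i \<in> g i) \<and> (\<forall>i. i \<notin> {1..s} \<longrightarrow> f i = 0) \<and>
        Y = (\<Sum>i\<in>{1..s}. f i)) \<and>
    (\<forall>i\<ge>2. g i = bracket_span (g (i - 1)) (g 1)) \<and>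
    (\<forall>i>s. g i = {0})"

text \<open>The linearly ordered index type \<open>'n\<close> plays the role of \<open>{1..n}\<close>; \<open>d\<close> is the degree.\<close>

definition adapted_basis ::
    "('n::{finite,linorder} pt \<Rightarrow> 'n pt \<Rightarrow> 'n pt) \<Rightarrow> nat \<Rightarrow> (nat \<Rightarrow> 'n vfield set) \<Rightarrow>
      ('n \<Rightarrow> 'n vfield) \<Rightarrow> bool"
  where "adapted_basis mul s g X \<longleftrightarrow>
    inj X \<and> independent (range X) \<and> span (range X) = lie_algebra mul \<and>
    (\<exists>d. (\<forall>j. d j \<in> {1..s} \<and> X j \<in> g (d j)) \<and> (\<forall>i j. i < j \<longrightarrow> d i \<le> d j))"

definition first_indices :: "nat \<Rightarrow> 'n::{finite,linorder} set"
  where "first_indices r = {j. card {..j} \<le> r}"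

subsection \<open>Exponential coordinates of the second type\<close>

text \<open>\<open>p = exp Y\<close>: the point \<open>p\<close> is the time-one value of the integral curve of \<open>Y\<close> that
  starts at the identity.\<close>

definition is_exp :: "'n::finite vfield \<Rightarrow> 'n pt \<Rightarrow> bool"
  where "is_exp Y p \<longleftrightarrow>
    (\<exists>c. c 0 = 0 \<and> (\<forall>t. (c has_vector_derivative Y (c t)) (at t)) \<and> c (1::real) = p)"

text \<open>\<open>x = exp (x\<^sub>n X\<^sub>n) \<cdot> \<dots> \<cdot> exp (x\<^sub>1 X\<^sub>1)\<close> for every \<open>x\<close>, the indices decreasing from left
  to right.\<close>

definition second_type_coordinates ::
    "('n::{finite,linorder} pt \<Rightarrow> 'n pt \<Rightarrow> 'n pt) \<Rightarrow> ('n \<Rightarrow> 'n vfield) \<Rightarrow> bool"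
  where "second_type_coordinates mul X \<longleftrightarrow>
    (\<forall>x. \<exists>p. (\<forall>j. is_exp ((x $ j) *\<^sub>R X j) (p j)) \<and>
      x = foldr (\<lambda>j. mul (p j)) (rev (sorted_list_of_set UNIV)) 0)"

subsection \<open>Structure constants and extremal polynomials\<close>

definition struct_const ::
    "('n::finite \<Rightarrow> 'n vfield) \<Rightarrow> 'n \<Rightarrow> 'n \<Rightarrow> 'n \<Rightarrow> real"
  where "struct_const X i j k = representation (range X) (lie_bracket (X i) (X j)) (X k)"

text \<open>Multi-indices \<open>\<alpha>\<close> are functions \<open>'n \<Rightarrow> nat\<close>; the smallest index is bracketed first.\<close>

definition iterated_bracket ::
    "('n::{finite,linorder} \<Rightarrow> 'n vfield) \<Rightarrow> 'n \<Rightarrow> ('n \<Rightarrow> nat) \<Rightarrow> 'n vfield"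
  where "iterated_bracket X i \<alpha> =
    fold (\<lambda>j. (\<lambda>Y. lie_bracket Y (X j)) ^^ \<alpha> j) (sorted_list_of_set UNIV) (X i)"

definition gen_struct_const ::
    "('n::{finite,linorder} \<Rightarrow> 'n vfield) \<Rightarrow> 'n \<Rightarrow> ('n \<Rightarrow> nat) \<Rightarrow> 'n \<Rightarrow> real"
  where "gen_struct_const X i \<alpha> k = representation (range X) (iterated_bracket X i \<alpha>) (X k)"

text \<open>By nilpotency only finitely many summands are nonzero.\<close>

definition extremal_poly ::
    "('n::{finite,linorder} \<Rightarrow> 'n vfield) \<Rightarrow> 'n pt \<Rightarrow> 'n \<Rightarrow> 'n pt \<Rightarrow> real"
  where "extremal_poly X v i x =
    (\<Sum>\<^sub>\<infinity>\<alpha>\<in>UNIV. (- 1) ^ (\<Sum>j\<in>UNIV. \<alpha> j) / (\<Prod>j\<in>UNIV. fact (\<alpha> j)) *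
        (\<Sum>k\<in>UNIV. gen_struct_const X i \<alpha> k * v $ k) * (\<Prod>j\<in>UNIV. (x $ j) ^ \<alpha> j))"

subsection \<open>Horizontal curves\<close>

definition lipschitz01 :: "(real \<Rightarrow> 'a::metric_space) \<Rightarrow> bool"
  where "lipschitz01 f \<longleftrightarrow> (\<exists>L. L-lipschitz_on {0..1} f)"

definition Linfty01 :: "(real \<Rightarrow> real) \<Rightarrow> bool"
  where "Linfty01 h \<longleftrightarrow> h \<in> borel_measurable (lebesgue_on {0..1}) \<and>
    (\<exists>C. AE t in lebesgue_on {0..1}. \<bar>h t\<bar> \<le> C)"

definition horizontal_curve ::
    "('n::{finite,linorder} \<Rightarrow> 'n vfield) \<Rightarrow> nat \<Rightarrow> (real \<Rightarrow> 'n pt) \<Rightarrow> bool"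
  where "horizontal_curve X r \<gamma> \<longleftrightarrow> lipschitz01 \<gamma> \<and>
    (\<exists>h. (\<forall>j\<in>first_indices r. Linfty01 (h j)) \<and>
      (AE t in lebesgue_on {0..1}.
        (\<gamma> has_vector_derivative (\<Sum>j\<in>first_indices r. h j t *\<^sub>R X j (\<gamma> t))) (at t within {0..1})))"

end

theory Submission
  imports Defs
begin

text \<open>
  The sum defining the extremal polynomials is a product of exponential series:
  \<open>P\<^sub>i\<^sup>v(x) = \<langle>v, Ad(x) X\<^sub>i\<rangle>\<close>, where \<open>Ad(x)\<close> is the matrix
  \<open>e\<^bsup>x\<^sub>n ad X\<^sub>n\<^esup> \<cdots> e\<^bsup>x\<^sub>1 ad X\<^sub>1\<^esup>\<close>. As \<open>Ad\<close> is
  multiplicative, its derivative along \<open>X\<^sub>j\<close> is \<open>Ad(x) ad X\<^sub>j\<close>, so along a horizontal curve the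
  functions \<open>P\<^sub>i\<^sup>v(\<gamma>)\<close> solve the adjoint equation. Conversely, if \<open>\<lambda>\<close> solves the equation, then
  the Lipschitz function \<open>\<lambda> Ad(\<gamma>)\<^sup>-\<^sup>1\<close> has derivative zero almost everywhere, so it is constant.

  Multiplicativity is obtained by characterising \<open>Ad(q)\<^sup>-\<^sup>1\<close> through the action of right translation
  by \<open>q\<close> on left-invariant fields; for \<open>q = exp (t X\<^sub>j)\<close> both sides of this relation solve the same
  linear differential equation. That \<open>\<gamma>\<^sub>j\<close> has derivative \<open>h\<^sub>j\<close> for \<open>j \<le> r\<close> follows because
  \<open>X\<^sub>j\<close> differs from the \<open>j\<close>-th coordinate field by fields of higher degree.
\<close>

subsection \<open>Smooth maps and Lie brackets of vector fields\<close>

abbreviation fd :: "('a::real_normed_vector \<Rightarrow> 'b::real_normed_vector) \<Rightarrow> 'a \<Rightarrow> 'a \<Rightarrow> 'b"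
  where "fd f x v \<equiv> frechet_derivative f (at x) v"

lemma smooth_has_derivative:
  assumes "smooth f" shows "(f has_derivative fd f x) (at x)"
proof -
  have "Ck (Suc 0) f" using assms by (simp add: smooth_def del: Ck.simps)
  then show ?thesis by (simp add: frechet_derivative_works)
qed

lemma smooth_fd:
  assumes "smooth f" shows "smooth (\<lambda>x. fd f x v)"
  unfolding smooth_def
proof
  fix k
  have "Ck (Suc k) f" using assms by (simp add: smooth_def del: Ck.simps)
  then show "Ck k (\<lambda>x. fd f x v)" by simp
qed

lemma smooth_continuous:
  assumes "smooth f" shows "continuous_on UNIV f"
  using assms Ck.simps(1) unfolding smooth_def by blast

lemma linear_fd: "smooth f \<Longrightarrow> linear (fd f x)"
  using has_derivative_linear smooth_has_derivative by blast

lemma fd_eqI: "(f has_derivative f') (at x) \<Longrightarrow> fd f x = f'"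
  using frechet_derivative_at by metis

text \<open>Differentiating along \<open>v\<close> gives the derivative of \<open>f\<close> along
  \<open>L v\<close>, again composed with the same affine map, so the induction on \<open>k\<close>
  closes. The purpose is to freeze one argument of the group multiplication.\<close>

lemma Ck_affine:
  fixes f :: "'a::euclidean_space \<Rightarrow> 'b::euclidean_space" and L :: "'c::euclidean_space \<Rightarrow> 'a"
  assumes "Ck k f" "bounded_linear L"
  shows "Ck k (\<lambda>y. f (a + L y))"
  using assms(1)
proof (induction k arbitrary: f)
  case 0
  have "continuous_on UNIV (\<lambda>y. a + L y)"
    using assms(2) by (intro continuous_intros linear_continuous_on)
  then show ?case using 0 continuous_on_compose2[of UNIV f UNIV "\<lambda>y. a + L y"] by simp
next
  case (Suc k)
  have A: "((\<lambda>y. a + L y) has_derivative L) (at y)" for y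
    using bounded_linear_imp_has_derivative[OF assms(2)]
    by (auto intro!: derivative_eq_intros)
  have f: "(f has_derivative fd f x) (at x)" for x
    using Suc.prems by (simp add: frechet_derivative_works)
  have D: "((\<lambda>y. f (a + L y)) has_derivative (\<lambda>v. fd f (a + L y) (L v))) (at y)" for y
    using has_derivative_compose[OF A f] .
  have "fd (\<lambda>y. f (a + L y)) y = (\<lambda>v. fd f (a + L y) (L v))" for y
    using fd_eqI[OF D] .
  then show ?case using D Suc.IH[of "\<lambda>x. fd f x (L _)"] Suc.prems
    by (auto simp: differentiable_def)
qed

lemma smooth_affine:
  fixes f :: "'a::euclidean_space \<Rightarrow> 'b::euclidean_space" and L :: "'c::euclidean_space \<Rightarrow> 'a"
  assumes "smooth f" "bounded_linear L"
  shows "smooth (\<lambda>y. f (a + L y))"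
  using assms Ck_affine unfolding smooth_def by blast

section \<open>Symmetry of second derivatives\<close>

text \<open>The mean value theorem is applied twice, first in the parameter along \<open>u\<close>,
  then in the one along \<open>v\<close>. Pairing with \<open>b\<close> makes the functions
  real-valued.\<close>

lemma second_difference:
  fixes f :: "'a::euclidean_space \<Rightarrow> 'b::euclidean_space"
  assumes f: "smooth f" and h: "h > 0"
  shows "\<exists>s t. 0 < s \<and> s < h \<and> 0 < t \<and> t < h \<and>
    (f (x + h *\<^sub>R u + h *\<^sub>R v) - f (x + h *\<^sub>R u) - f (x + h *\<^sub>R v) + f x) \<bullet> b =
    h\<^sup>2 * (fd (\<lambda>p. fd f p u) (x + s *\<^sub>R u + t *\<^sub>R v) v \<bullet> b)"
proof -
  define g where "g = (\<lambda>s. (f (x + s *\<^sub>R u + h *\<^sub>R v) - f (x + s *\<^sub>R u)) \<bullet> b)"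
  have D1: "((\<lambda>s. f (c + s *\<^sub>R u)) has_derivative (\<lambda>d. d *\<^sub>R fd f (c + s *\<^sub>R u) u)) (at s)" for c s
  proof -
    have "((\<lambda>s. c + s *\<^sub>R u) has_derivative (\<lambda>d. d *\<^sub>R u)) (at s)"
      by (auto intro!: derivative_eq_intros)
    from has_derivative_compose[OF this smooth_has_derivative[OF f]]
    show ?thesis using linear_fd[OF f] by (simp add: linear_scale)
  qed
  have D2: "((\<lambda>t. fd f (c + t *\<^sub>R v) u) has_derivative
      (\<lambda>d. d *\<^sub>R fd (\<lambda>p. fd f p u) (c + t *\<^sub>R v) v)) (at t)" for c t
  proof -
    have "((\<lambda>s. c + s *\<^sub>R v) has_derivative (\<lambda>d. d *\<^sub>R v)) (at t)"
      by (auto intro!: derivative_eq_intros)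
    from has_derivative_compose[OF this smooth_has_derivative[OF smooth_fd[OF f]]]
    show ?thesis using linear_fd[OF smooth_fd[OF f]] by (simp add: linear_scale)
  qed
  have Dg: "(g has_real_derivative
      (fd f (x + s *\<^sub>R u + h *\<^sub>R v) u - fd f (x + s *\<^sub>R u) u) \<bullet> b) (at s)" for s
  proof -
    have "((\<lambda>s. f ((x + h *\<^sub>R v) + s *\<^sub>R u)) has_derivative
      (\<lambda>d. d *\<^sub>R fd f ((x + h *\<^sub>R v) + s *\<^sub>R u) u)) (at s)" by (rule D1)
    moreover have "(x + h *\<^sub>R v) + s *\<^sub>R u = x + s *\<^sub>R u + h *\<^sub>R v" for s by simp
    ultimately have "((\<lambda>s. f (x + s *\<^sub>R u + h *\<^sub>R v)) has_derivative
      (\<lambda>d. d *\<^sub>R fd f (x + s *\<^sub>R u + h *\<^sub>R v) u)) (at s)" by simp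
    then have "(g has_derivative (\<lambda>d. (d *\<^sub>R fd f (x + s *\<^sub>R u + h *\<^sub>R v) u -
        d *\<^sub>R fd f (x + s *\<^sub>R u) u) \<bullet> b)) (at s)"
      unfolding g_def by (intro has_derivative_inner_left has_derivative_diff D1)
    moreover have "(\<lambda>d. (d *\<^sub>R fd f (x + s *\<^sub>R u + h *\<^sub>R v) u - d *\<^sub>R fd f (x + s *\<^sub>R u) u) \<bullet> b) =
        (*) ((fd f (x + s *\<^sub>R u + h *\<^sub>R v) u - fd f (x + s *\<^sub>R u) u) \<bullet> b)"
      by (simp add: fun_eq_iff inner_diff_left right_diff_distrib mult.commute)
    ultimately show ?thesis by (simp add: has_field_derivative_def)
  qed
  obtain s where s: "0 < s" "s < h"
    "g h - g 0 = (h - 0) * ((fd f (x + s *\<^sub>R u + h *\<^sub>R v) u - fd f (x + s *\<^sub>R u) u) \<bullet> b)"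
    using MVT2[OF h Dg] by blast
  define k where "k = (\<lambda>t. fd f (x + s *\<^sub>R u + t *\<^sub>R v) u \<bullet> b)"
  have Dk: "(k has_real_derivative fd (\<lambda>p. fd f p u) (x + s *\<^sub>R u + t *\<^sub>R v) v \<bullet> b) (at t)" for t
    using has_derivative_inner_left[OF D2[of "x + s *\<^sub>R u" t], of b]
    by (simp add: has_field_derivative_def k_def mult_commute_abs)
  obtain t where t: "0 < t" "t < h"
    "k h - k 0 = (h - 0) * (fd (\<lambda>p. fd f p u) (x + s *\<^sub>R u + t *\<^sub>R v) v \<bullet> b)"
    using MVT2[OF h Dk] by blast
  have "(f (x + h *\<^sub>R u + h *\<^sub>R v) - f (x + h *\<^sub>R u) - f (x + h *\<^sub>R v) + f x) \<bullet> b = g h - g 0"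
    by (simp add: g_def inner_diff_left inner_add_left)
  also have "\<dots> = h * (k h - k 0)" using s(3) by (simp add: k_def inner_diff_left)
  also have "\<dots> = h\<^sup>2 * (fd (\<lambda>p. fd f p u) (x + s *\<^sub>R u + t *\<^sub>R v) v \<bullet> b)"
    using t(3) by (simp add: power2_eq_square)
  finally show ?thesis using s t by blast
qed

text \<open>The second difference at scale \<open>h n\<close> is symmetric in \<open>u\<close> and
  \<open>v\<close>. After division by its square, both mixed derivatives are taken at points that
  tend to \<open>x\<close>, and continuity identifies the limits.\<close>

lemma second_derivative_symmetric:
  fixes f :: "'a::euclidean_space \<Rightarrow> 'b::euclidean_space"
  assumes f: "smooth f"
  shows "fd (\<lambda>p. fd f p u) x v = fd (\<lambda>p. fd f p v) x u"
proof (rule euclidean_eqI)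
  fix b :: 'b
  define h where "h = (\<lambda>n::nat. inverse (real (Suc n)))"
  have h0: "h n > 0" for n by (simp add: h_def)
  have hl: "h \<longlonglongrightarrow> 0" unfolding h_def by (rule LIMSEQ_inverse_real_of_nat)
  have lim: "(\<lambda>n. fd (\<lambda>p. fd f p u) (x + s n *\<^sub>R u + t n *\<^sub>R v) v \<bullet> b) \<longlonglongrightarrow> fd (\<lambda>p. fd f p u) x v \<bullet> b"
    if "\<And>n. 0 < s n \<and> s n < h n" "\<And>n. 0 < t n \<and> t n < h n" for s t and u v :: 'a
  proof -
    have "s \<longlonglongrightarrow> 0" "t \<longlonglongrightarrow> 0"
      by (rule tendsto_sandwich[of "\<lambda>_. 0" _ _ h];
          use that hl in \<open>auto intro: less_imp_le always_eventually\<close>)+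
    then have "(\<lambda>n. x + s n *\<^sub>R u + t n *\<^sub>R v) \<longlonglongrightarrow> x + 0 *\<^sub>R u + 0 *\<^sub>R v" by (intro tendsto_intros)
    moreover have "isCont (\<lambda>p. fd (\<lambda>p. fd f p u) p v) (x + 0 *\<^sub>R u + 0 *\<^sub>R v)"
      using smooth_continuous[OF smooth_fd[OF smooth_fd[OF f]]]
      by (simp add: continuous_on_eq_continuous_at)
    ultimately show ?thesis
      using isCont_tendsto_compose by (intro tendsto_inner tendsto_const) fastforce
  qed
  have "\<forall>n. \<exists>st. 0 < fst st \<and> fst st < h n \<and> 0 < snd st \<and> snd st < h n \<and>
    (f (x + h n *\<^sub>R u + h n *\<^sub>R v) - f (x + h n *\<^sub>R u) - f (x + h n *\<^sub>R v) + f x) \<bullet> b =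
    (h n)\<^sup>2 * (fd (\<lambda>p. fd f p u) (x + fst st *\<^sub>R u + snd st *\<^sub>R v) v \<bullet> b)" for u v
    using second_difference[OF f h0] by fastforce
  then have ex: "\<exists>st. \<forall>n. 0 < fst (st n) \<and> fst (st n) < h n \<and> 0 < snd (st n) \<and> snd (st n) < h n \<and>
    (f (x + h n *\<^sub>R u + h n *\<^sub>R v) - f (x + h n *\<^sub>R u) - f (x + h n *\<^sub>R v) + f x) \<bullet> b =
    (h n)\<^sup>2 * (fd (\<lambda>p. fd f p u) (x + fst (st n) *\<^sub>R u + snd (st n) *\<^sub>R v) v \<bullet> b)" for u v
    by (rule choice)
  obtain st where st: "\<forall>n. 0 < fst (st n) \<and> fst (st n) < h n \<and> 0 < snd (st n) \<and> snd (st n) < h n \<and>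
    (f (x + h n *\<^sub>R u + h n *\<^sub>R v) - f (x + h n *\<^sub>R u) - f (x + h n *\<^sub>R v) + f x) \<bullet> b =
    (h n)\<^sup>2 * (fd (\<lambda>p. fd f p u) (x + fst (st n) *\<^sub>R u + snd (st n) *\<^sub>R v) v \<bullet> b)"
    using ex by blast
  obtain st' where st': "\<forall>n. 0 < fst (st' n) \<and> fst (st' n) < h n \<and> 0 < snd (st' n) \<and> snd (st' n) < h n \<and>
    (f (x + h n *\<^sub>R v + h n *\<^sub>R u) - f (x + h n *\<^sub>R v) - f (x + h n *\<^sub>R u) + f x) \<bullet> b =
    (h n)\<^sup>2 * (fd (\<lambda>p. fd f p v) (x + fst (st' n) *\<^sub>R v + snd (st' n) *\<^sub>R u) u \<bullet> b)"
    using ex by blast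
  have "f (x + h n *\<^sub>R v + h n *\<^sub>R u) - f (x + h n *\<^sub>R v) - f (x + h n *\<^sub>R u) + f x =
     f (x + h n *\<^sub>R u + h n *\<^sub>R v) - f (x + h n *\<^sub>R u) - f (x + h n *\<^sub>R v) + f x" for n
    by (simp add: add.assoc add.commute[of "h n *\<^sub>R u"])
  then have "(h n)\<^sup>2 * (fd (\<lambda>p. fd f p u) (x + fst (st n) *\<^sub>R u + snd (st n) *\<^sub>R v) v \<bullet> b) =
      (h n)\<^sup>2 * (fd (\<lambda>p. fd f p v) (x + fst (st' n) *\<^sub>R v + snd (st' n) *\<^sub>R u) u \<bullet> b)" for n
    using st st' by metis
  then have eq: "fd (\<lambda>p. fd f p u) (x + fst (st n) *\<^sub>R u + snd (st n) *\<^sub>R v) v \<bullet> b =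
      fd (\<lambda>p. fd f p v) (x + fst (st' n) *\<^sub>R v + snd (st' n) *\<^sub>R u) u \<bullet> b" for n
    by (metis h0 less_irrefl mult_cancel_left zero_less_power)
  show "fd (\<lambda>p. fd f p u) x v \<bullet> b = fd (\<lambda>p. fd f p v) x u \<bullet> b"
    using lim[of "fst \<circ> st" "snd \<circ> st" u v] lim[of "fst \<circ> st'" "snd \<circ> st'" v u] st st'
      LIMSEQ_unique by (simp add: eq) blast
qed

text \<open>Expanding the direction \<open>Y q\<close> in the standard basis leaves a finite sum of
  scalar functions times derivatives of \<open>F\<close> in fixed directions, to which the product
  rule applies.\<close>

lemma has_derivative_fd:
  fixes F :: "'a::euclidean_space \<Rightarrow> 'b::euclidean_space"
  assumes F: "smooth F" and A: "(A has_derivative A') (at p within S)"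
    and Y: "(Y has_derivative Y') (at p within S)"
  shows "((\<lambda>q. fd F (A q) (Y q)) has_derivative
    (\<lambda>u. fd (\<lambda>z. fd F z (Y p)) (A p) (A' u) + fd F (A p) (Y' u))) (at p within S)"
proof -
  have lin: "fd F z w = (\<Sum>b\<in>Basis. (w \<bullet> b) *\<^sub>R fd F z b)" for z w
    using linear_sum[OF linear_fd[OF F], of z "\<lambda>b. (w \<bullet> b) *\<^sub>R b" Basis]
    by (simp add: euclidean_representation linear_scale[OF linear_fd[OF F]])
  have D2: "((\<lambda>z. fd F z b) has_derivative fd (\<lambda>z. fd F z b) z) (at z)" for z b
    by (rule smooth_has_derivative[OF smooth_fd[OF F]])
  have "((\<lambda>z. \<Sum>b\<in>Basis. (Y p \<bullet> b) *\<^sub>R fd F z b) has_derivative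
      (\<lambda>u. \<Sum>b\<in>Basis. (Y p \<bullet> b) *\<^sub>R fd (\<lambda>z. fd F z b) z u)) (at z)" for z
    by (intro has_derivative_sum has_derivative_scaleR_right D2)
  then have "((\<lambda>z. fd F z (Y p)) has_derivative
      (\<lambda>u. \<Sum>b\<in>Basis. (Y p \<bullet> b) *\<^sub>R fd (\<lambda>z. fd F z b) z u)) (at z)" for z
    by (simp only: lin[of _ "Y p"])
  from fd_eqI[OF this]
  have D3: "fd (\<lambda>z. fd F z (Y p)) z u = (\<Sum>b\<in>Basis. (Y p \<bullet> b) *\<^sub>R fd (\<lambda>z. fd F z b) z u)" for z u
    by (rule fun_cong)
  have "((\<lambda>q. \<Sum>b\<in>Basis. (Y q \<bullet> b) *\<^sub>R fd F (A q) b) has_derivative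
      (\<lambda>u. \<Sum>b\<in>Basis. (Y p \<bullet> b) *\<^sub>R fd (\<lambda>z. fd F z b) (A p) (A' u) + (Y' u \<bullet> b) *\<^sub>R fd F (A p) b))
      (at p within S)"
    by (intro has_derivative_sum has_derivative_scaleR has_derivative_inner_left Y
        has_derivative_compose[OF A D2])
  then show ?thesis
    by (subst lin, subst D3, subst (2) lin, subst sum.distrib[symmetric])
qed

section \<open>Algebra of the Lie bracket of vector fields\<close>

text \<open>Differentiating each relation along the other field produces a second derivative of
  \<open>F\<close>; by symmetry these terms cancel in the bracket. With \<open>F\<close> a left
  translation, brackets of left-invariant fields turn out left-invariant.\<close>

lemma lie_bracket_related:
  assumes F: "smooth F" and s: "smooth Y" "smooth Z" "smooth Y'" "smooth Z'"
    and Y: "\<And>y. Y (F y) = fd F y (Y' y)" and Z: "\<And>y. Z (F y) = fd F y (Z' y)"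
  shows "lie_bracket Y Z (F y) = fd F y (lie_bracket Y' Z' y)"
proof -
  have *: "fd Z (F y) (Y (F y)) = fd (\<lambda>z. fd F z (Z' y)) y (Y' y) + fd F y (fd Z' y (Y' y))"
    if s: "smooth Y" "smooth Z" "smooth Y'" "smooth Z'"
      and Y: "\<And>y. Y (F y) = fd F y (Y' y)" and Z: "\<And>y. Z (F y) = fd F y (Z' y)" for Y Z Y' Z'
  proof -
    have "((\<lambda>y. Z (F y)) has_derivative (\<lambda>u. fd Z (F y) (fd F y u))) (at y)"
      by (rule has_derivative_compose[OF smooth_has_derivative[OF F] smooth_has_derivative[OF s(2)]])
    moreover have "((\<lambda>y. fd F y (Z' y)) has_derivative
        (\<lambda>u. fd (\<lambda>z. fd F z (Z' y)) y u + fd F y (fd Z' y u))) (at y)"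
      by (rule has_derivative_fd[OF F has_derivative_ident smooth_has_derivative[OF s(4)]])
    ultimately have "(\<lambda>u. fd Z (F y) (fd F y u)) =
        (\<lambda>u. fd (\<lambda>z. fd F z (Z' y)) y u + fd F y (fd Z' y u))"
      unfolding Z by (rule has_derivative_unique)
    from fun_cong[OF this, of "Y' y"] show ?thesis by (simp add: Y)
  qed
  show ?thesis
    unfolding lie_bracket_def *[OF s Y Z] *[OF s(2,1,4,3) Z Y]
      second_derivative_symmetric[OF F, of "Z' y" _ "Y' y"]
    using linear_diff[OF linear_fd[OF F]] by simp
qed

lemma has_derivative_lie_bracket:
  assumes "smooth Y" "smooth Z"
  shows "(lie_bracket Y Z has_derivative
    (\<lambda>u. fd (\<lambda>q. fd Z q (Y p)) p u + fd Z p (fd Y p u)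
      - (fd (\<lambda>q. fd Y q (Z p)) p u + fd Y p (fd Z p u)))) (at p)"
  unfolding lie_bracket_def
  by (intro has_derivative_diff has_derivative_fd[OF _ has_derivative_ident] assms
      smooth_has_derivative)

text \<open>Once all brackets are expanded by the product rule, the second derivatives cancel by
  symmetry, one instance for each of the three fields.\<close>

lemma lie_bracket_jacobi:
  fixes X Y Z :: "'n::finite vfield"
  assumes "smooth X" "smooth Y" "smooth Z"
  shows "lie_bracket X (lie_bracket Y Z) = lie_bracket (lie_bracket X Y) Z + lie_bracket Y (lie_bracket X Z)"
proof
  fix p
  have D: "fd (lie_bracket Y Z) p u = fd (\<lambda>q. fd Z q (Y p)) p u + fd Z p (fd Y p u)
      - (fd (\<lambda>q. fd Y q (Z p)) p u + fd Y p (fd Z p u))" if "smooth Y" "smooth Z" for Y Z :: "'n vfield" and u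
    using fd_eqI[OF has_derivative_lie_bracket[OF that]] by metis
  have B: "lie_bracket Y Z p = fd Z p (Y p) - fd Y p (Z p)" for Y Z :: "'n vfield" by (simp add: lie_bracket_def)
  show "lie_bracket X (lie_bracket Y Z) p = (lie_bracket (lie_bracket X Y) Z + lie_bracket Y (lie_bracket X Z)) p"
    unfolding plus_fun_apply lie_bracket_def[of X "lie_bracket Y Z"] lie_bracket_def[of Y "lie_bracket X Z"]
      lie_bracket_def[of "lie_bracket X Y" Z]
    using second_derivative_symmetric[OF assms(1), of "Y p" p "Z p"]
      second_derivative_symmetric[OF assms(2), of "Z p" p "X p"]
      second_derivative_symmetric[OF assms(3), of "Y p" p "X p"]
    by (simp add: D assms B linear_diff[OF linear_fd] algebra_simps)
qed

lemma lie_bracket_add_left: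
  assumes "smooth Y" "smooth Y'" "smooth Z"
  shows "lie_bracket (Y + Y') Z = lie_bracket Y Z + lie_bracket Y' Z"
proof
  fix p
  have "((Y + Y') has_derivative (\<lambda>u. fd Y p u + fd Y' p u)) (at p)"
    using has_derivative_add[OF smooth_has_derivative smooth_has_derivative] assms
    by (auto simp: plus_fun_def)
  from fd_eqI[OF this] show "lie_bracket (Y + Y') Z p = (lie_bracket Y Z + lie_bracket Y' Z) p"
    using linear_add[OF linear_fd[OF assms(3)]] by (simp add: lie_bracket_def)
qed

lemma lie_bracket_scaleR_left:
  assumes "smooth Y" "smooth Z"
  shows "lie_bracket (c *\<^sub>R Y) Z = c *\<^sub>R lie_bracket Y Z"
proof
  fix p
  have "((c *\<^sub>R Y) has_derivative (\<lambda>u. c *\<^sub>R fd Y p u)) (at p)"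
    using has_derivative_scaleR_right[OF smooth_has_derivative[OF assms(1)]]
    by (auto simp: scaleR_fun_def)
  from fd_eqI[OF this] show "lie_bracket (c *\<^sub>R Y) Z p = (c *\<^sub>R lie_bracket Y Z) p"
    using linear_scale[OF linear_fd[OF assms(2)]]
    by (simp add: lie_bracket_def scaleR_fun_def scaleR_diff_right)
qed

lemma lie_bracket_swap: "lie_bracket Y Z = - lie_bracket Z Y"
  by (simp add: lie_bracket_def fun_eq_iff)

subsection \<open>Uniqueness for differential equations and Lipschitz functions\<close>

text \<open>By Cauchy-Schwarz the squared norm of \<open>E t\<close> times
  \<open>exp (- 2 * K * t)\<close> is nonincreasing; it is nonnegative and starts at zero.\<close>

lemma gronwall_zero_nonneg:
  fixes E :: "real \<Rightarrow> 'a::euclidean_space"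
  assumes D: "\<And>t. (E has_vector_derivative E' t) (at t)" and E0: "E 0 = 0"
    and K: "\<And>t. 0 \<le> t \<Longrightarrow> t \<le> T \<Longrightarrow> norm (E' t) \<le> K * norm (E t)" and T: "0 \<le> T"
  shows "E T = 0"
proof -
  define f where "f = (\<lambda>t. (E t \<bullet> E t) * exp (- 2 * K * t))"
  have f': "(f has_real_derivative (2 * (E t \<bullet> E' t) - 2 * K * (E t \<bullet> E t)) * exp (- 2 * K * t)) (at t)" for t
  proof -
    have "((\<lambda>t. E t \<bullet> E t) has_derivative (\<lambda>h. E t \<bullet> (h *\<^sub>R E' t) + (h *\<^sub>R E' t) \<bullet> E t)) (at t)"
      using D[of t] unfolding has_vector_derivative_def by (intro has_derivative_inner)
    moreover have "(\<lambda>h. E t \<bullet> (h *\<^sub>R E' t) + (h *\<^sub>R E' t) \<bullet> E t) = (*) (2 * (E t \<bullet> E' t))"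
      by (simp add: fun_eq_iff inner_commute)
    ultimately have "((\<lambda>t. E t \<bullet> E t) has_real_derivative 2 * (E t \<bullet> E' t)) (at t)"
      by (simp add: has_field_derivative_def)
    then show ?thesis unfolding f_def
      by (auto intro!: derivative_eq_intros simp: algebra_simps)
  qed
  have "f T \<le> f 0"
  proof (rule DERIV_nonpos_imp_nonincreasing[OF T])
    fix t assume t: "0 \<le> t" "t \<le> T"
    have "E t \<bullet> E' t \<le> norm (E t) * norm (E' t)" by (rule norm_cauchy_schwarz)
    also have "\<dots> \<le> norm (E t) * (K * norm (E t))" using K[OF t] by (intro mult_left_mono) auto
    also have "\<dots> = K * (E t \<bullet> E t)"
      by (simp add: dot_square_norm power2_eq_square)
    finally have "(2 * (E t \<bullet> E' t) - 2 * K * (E t \<bullet> E t)) * exp (- 2 * K * t) \<le> 0"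
      by (intro mult_nonpos_nonneg) auto
    then show "\<exists>y. DERIV f t :> y \<and> y \<le> 0" using f' by blast
  qed
  then have "(E T \<bullet> E T) * exp (- 2 * K * T) \<le> 0" by (simp add: f_def E0)
  then show ?thesis
    by (metis exp_gt_zero inner_gt_zero_iff mult_pos_pos not_le)
qed

lemma gronwall_zero:
  fixes E :: "real \<Rightarrow> 'a::euclidean_space"
  assumes D: "\<And>t. (E has_vector_derivative E' t) (at t)" and E0: "E 0 = 0"
    and K: "\<And>t. \<bar>t\<bar> \<le> R \<Longrightarrow> norm (E' t) \<le> K * norm (E t)" and R: "\<bar>T\<bar> \<le> R"
  shows "E T = 0"
proof (cases "0 \<le> T")
  case True
  show ?thesis using K R by (intro gronwall_zero_nonneg[OF D E0 _ True, of K]) auto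
next
  case False
  \<comment> \<open>Negative times are reduced to positive ones by reversing time.\<close>
  have D': "((\<lambda>t. E (- t)) has_vector_derivative - E' (- t)) (at t)" for t
  proof -
    have "(uminus has_vector_derivative (-1::real)) (at t)"
      by (auto intro!: derivative_eq_intros)
    from vector_diff_chain_at[OF this D] show ?thesis by (simp add: o_def)
  qed
  have "E (- (- T)) = 0"
    using False K R E0 by (intro gronwall_zero_nonneg[OF D', of "- T" K]) auto
  then show ?thesis by simp
qed

section \<open>Lipschitz functions whose derivative vanishes almost everywhere\<close>

text \<open>The image of the interval is a null set: a Lipschitz map sends the exceptional null set
  to a null set, and Sard's theorem handles the points with derivative zero. Being an interval as
  well, the image is a single point.\<close>

lemma lipschitz_ae_zero_derivative_constant:
  fixes f :: "real \<Rightarrow> real"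
  assumes L: "L-lipschitz_on {0..1} f"
    and D: "AE t in lebesgue_on {0..1}. (f has_real_derivative 0) (at t within {0..1})"
    and t: "t \<in> {0..1}"
  shows "f t = f 0"
proof -
  define N where "N = {t \<in> {0..1}. \<not> (f has_real_derivative 0) (at t within {0..1})}"
  have "AE t in lebesgue. t \<in> {0..1} \<longrightarrow> (f has_real_derivative 0) (at t within {0..1})"
    using D by (simp add: AE_restrict_space_iff)
  then obtain M where M: "M \<in> null_sets lebesgue"
      "{t \<in> space lebesgue. \<not> (t \<in> {0..1} \<longrightarrow> (f has_real_derivative 0) (at t within {0..1}))} \<subseteq> M"
    unfolding eventually_ae_filter by blast
  then have N: "negligible N"
    unfolding negligible_iff_null_sets[symmetric] N_def by (rule_tac negligible_subset) auto
  have "negligible (f ` N)"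
  proof (rule negligible_locally_Lipschitz_image[OF _ N], simp)
    fix x assume "x \<in> N"
    then have "\<forall>y\<in>N \<inter> UNIV. norm (f y - f x) \<le> L * norm (y - x)"
      using lipschitz_onD[OF L] by (auto simp: N_def dist_norm)
    then show "\<exists>T B. open T \<and> x \<in> T \<and> (\<forall>y\<in>N \<inter> T. norm (f y - f x) \<le> B * norm (y - x))"
      by blast
  qed
  moreover have "negligible (f ` ({0..1} - N))"
  proof -
    \<comment> \<open>\<open>baby_Sard\<close> speaks of maps between spaces \<open>real^'n\<close>,
      so \<open>f\<close> is transported to \<open>real^1\<close>, where the zero matrix has rank
      below 1.\<close>
    define S where "S = {x::real^1. x $ 1 \<in> {0..1} - N}"
    define F where "F = (\<lambda>x::real^1. f (x $ 1) *\<^sub>R (axis 1 1 :: real^1))"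
    have "negligible (F ` S)"
    proof (rule baby_Sard)
      fix x assume x: "x \<in> S"
      have f0: "(f has_derivative (\<lambda>_. 0)) (at (x $ 1) within {0..1})"
        using x by (auto simp: S_def N_def has_field_derivative_def lambda_zero)
      have "((\<lambda>x::real^1. f (x $ 1)) has_derivative (\<lambda>h. 0)) (at x within S)"
        by (rule has_derivative_in_compose[of "\<lambda>x. x $ 1" "\<lambda>h. h $ 1", OF _ has_derivative_subset[OF f0]])
          (auto intro!: bounded_linear_imp_has_derivative bounded_linear_vec_nth simp: S_def)
      then show "(F has_derivative (\<lambda>h. 0)) (at x within S)"
        unfolding F_def using has_derivative_scaleR_left by fastforce
      have "matrix (\<lambda>h::real^1. 0 :: real^1) = 0"
        by (simp add: matrix_def vec_eq_iff)
      then show "rank (matrix (\<lambda>h::real^1. 0 :: real^1)) < CARD(1)"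
        by simp
    qed simp
    then have "negligible ((\<lambda>y. y $ 1) ` F ` S)"
    proof (rule negligible_locally_Lipschitz_image[rotated])
      fix x assume "x \<in> F ` S"
      show "\<exists>T B. open T \<and> x \<in> T \<and> (\<forall>y\<in>F ` S \<inter> T. norm (y $ 1 - x $ 1) \<le> B * norm (y - x))"
        using component_le_norm_cart[of "_ - x" 1] by (intro exI[of _ UNIV] exI[of _ 1]) auto
    qed simp
    moreover have "f ` ({0..1} - N) \<subseteq> (\<lambda>y. y $ 1) ` F ` S"
    proof
      fix y assume "y \<in> f ` ({0..1} - N)"
      then obtain s where "s \<in> {0..1} - N" "y = f s" by blast
      then show "y \<in> (\<lambda>y. y $ 1) ` F ` S"
        unfolding image_image by (intro image_eqI[of _ _ "\<chi> i. s"]) (auto simp: F_def S_def)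
    qed
    ultimately show ?thesis by (rule negligible_subset)
  qed
  ultimately have "negligible (f ` N \<union> f ` ({0..1} - N))" by (rule negligible_Un)
  moreover have "f ` {0..1} \<subseteq> f ` N \<union> f ` ({0..1} - N)" by auto
  ultimately have neg: "negligible (f ` {0..1})" by (rule negligible_subset)
  have "is_interval (f ` {0..1})"
    using connected_continuous_image[OF lipschitz_on_continuous_on[OF L]]
    by (simp add: is_interval_connected_1)
  then have "x \<in> f ` {0..1}" if "a \<in> f ` {0..1}" "b \<in> f ` {0..1}" "a \<le> x" "x \<le> b" for a b x
    using that unfolding is_interval_1 by blast
  from this[of "f 0" "f t"] this[of "f t" "f 0"]
  have sub: "{min (f 0) (f t)..max (f 0) (f t)} \<subseteq> f ` {0..1}"
    using t by (auto simp: min_def max_def)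
  then have "negligible (cbox (min (f 0) (f t)) (max (f 0) (f t)))"
    using negligible_subset[OF neg sub] by simp
  then show ?thesis
    unfolding negligible_interval by (auto simp: min_def max_def split: if_splits)
qed

section \<open>Closure properties of Lipschitz functions on the unit interval\<close>

lemma lipschitz01_scaleR:
  fixes f :: "real \<Rightarrow> real" and g :: "real \<Rightarrow> 'a::real_normed_vector"
  assumes "lipschitz01 f" "lipschitz01 g"
  shows "lipschitz01 (\<lambda>t. f t *\<^sub>R g t)"
proof -
  obtain L M where L: "L-lipschitz_on {0..1} f" and M: "M-lipschitz_on {0..1} g"
    using assms by (auto simp: lipschitz01_def)
  have "bounded (f ` {0..1})" "bounded (g ` {0..1})"
    using L M by (auto intro!: compact_imp_bounded compact_continuous_image lipschitz_on_continuous_on)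
  then obtain A B where A: "\<And>t. t \<in> {0..1} \<Longrightarrow> norm (f t) \<le> A" "A > 0"
    and B: "\<And>t. t \<in> {0..1} \<Longrightarrow> norm (g t) \<le> B" "B > 0"
    unfolding bounded_pos by (metis imageI)
  have "(A * M + L * B)-lipschitz_on {0..1} (\<lambda>t. f t *\<^sub>R g t)"
  proof (rule lipschitz_onI)
    fix s t :: real assume st: "s \<in> {0..1}" "t \<in> {0..1}"
    have "dist (f s *\<^sub>R g s) (f t *\<^sub>R g t) = norm (f s *\<^sub>R (g s - g t) + (f s - f t) *\<^sub>R g t)"
      by (simp add: dist_norm algebra_simps)
    also have "\<dots> \<le> norm (f s) * norm (g s - g t) + norm (f s - f t) * norm (g t)"
      by (metis norm_scaleR norm_triangle_ineq real_norm_def)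
    also have "\<dots> \<le> A * (M * dist s t) + (L * dist s t) * B"
      using A B st lipschitz_onD[OF L st] lipschitz_onD[OF M st]
        lipschitz_on_nonneg[OF L] lipschitz_on_nonneg[OF M]
      by (intro add_mono mult_mono) (auto simp: dist_norm)
    finally show "dist (f s *\<^sub>R g s) (f t *\<^sub>R g t) \<le> (A * M + L * B) * dist s t"
      by (simp add: algebra_simps)
  qed (use A B lipschitz_on_nonneg[OF L] lipschitz_on_nonneg[OF M] in auto)
  then show ?thesis by (auto simp: lipschitz01_def)
qed

lemma lipschitz01_linear:
  assumes "bounded_linear h" "lipschitz01 f"
  shows "lipschitz01 (\<lambda>t. h (f t))"
proof -
  obtain L where L: "L-lipschitz_on {0..1} f" using assms(2) by (auto simp: lipschitz01_def)
  obtain K where "K-lipschitz_on (f ` {0..1}) h" using bounded_linear.lipschitz_boundE[OF assms(1)] .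
  then show ?thesis using lipschitz_on_compose2[OF L] by (auto simp: lipschitz01_def)
qed

lemma lipschitz01_sum:
  fixes f :: "'i \<Rightarrow> real \<Rightarrow> 'a::real_normed_vector"
  assumes "\<And>i. i \<in> I \<Longrightarrow> lipschitz01 (f i)"
  shows "lipschitz01 (\<lambda>t. \<Sum>i\<in>I. f i t)"
  using assms
proof (induction I rule: infinite_finite_induct)
  case (insert i I)
  then obtain L M where "L-lipschitz_on {0..1} (f i)" "M-lipschitz_on {0..1} (\<lambda>t. \<Sum>i\<in>I. f i t)"
    unfolding lipschitz01_def by blast
  from lipschitz_on_add[OF this] show ?case using insert by (auto simp: lipschitz01_def)
qed (auto simp: lipschitz01_def intro: lipschitz_on_constant)

lemma lipschitz01_const: "lipschitz01 (\<lambda>_. c)"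
  by (auto simp: lipschitz01_def intro: lipschitz_on_constant)

section \<open>Derivative bounds and uniqueness of integral curves\<close>

text \<open>The derivatives in the finitely many basis directions are continuous, hence bounded on
  \<open>C\<close>. This supplies the constants for the Gronwall arguments.\<close>

lemma fd_bound:
  assumes F: "smooth F" and C: "compact C"
  shows "\<exists>K. \<forall>p\<in>C. \<forall>u. norm (fd F p u) \<le> K * norm u"
proof -
  have "continuous_on C (\<lambda>p. \<Sum>b\<in>Basis. norm (fd F p b))"
    using smooth_continuous[OF smooth_fd[OF F]]
    by (intro continuous_intros) (auto intro: continuous_on_subset)
  from compact_imp_bounded[OF compact_continuous_image[OF this C]]
  obtain K where K: "\<And>p. p \<in> C \<Longrightarrow> norm (\<Sum>b\<in>Basis. norm (fd F p b)) \<le> K"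
    unfolding bounded_iff by blast
  have "norm (fd F p u) \<le> K * norm u" if "p \<in> C" for p u
  proof -
    have "fd F p u = (\<Sum>b\<in>Basis. (u \<bullet> b) *\<^sub>R fd F p b)"
      using linear_sum[OF linear_fd[OF F], of p "\<lambda>b. (u \<bullet> b) *\<^sub>R b" Basis]
      by (simp add: euclidean_representation linear_scale[OF linear_fd[OF F]])
    also have "norm \<dots> \<le> (\<Sum>b\<in>Basis. norm u * norm (fd F p b))"
      by (rule sum_norm_le) (simp add: Basis_le_norm mult_right_mono)
    also have "\<dots> = norm u * (\<Sum>b\<in>Basis. norm (fd F p b))" by (simp add: sum_distrib_left)
    also have "\<dots> \<le> norm u * K" using K[OF that] by (intro mult_left_mono) auto
    finally show ?thesis by (simp add: mult.commute)
  qed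
  then show ?thesis by blast
qed

text \<open>On a bounded time interval both curves stay in one ball. The ball is convex and the
  derivative of \<open>Y\<close> is bounded on it, so \<open>Y\<close> is Lipschitz there and
  Gronwall applies to the difference of the curves.\<close>

lemma integral_curve_unique:
  fixes Y :: "'a::euclidean_space \<Rightarrow> 'a"
  assumes Y: "smooth Y" and c: "\<And>t. (c has_vector_derivative Y (c t)) (at t)"
    and c': "\<And>t. (c' has_vector_derivative Y (c' t)) (at t)" and 0: "c 0 = c' 0"
  shows "c T = c' T"
proof -
  let ?I = "{- \<bar>T\<bar>..\<bar>T\<bar>}"
  have "continuous_on ?I c" "continuous_on ?I c'"
    using c c' by (auto intro!: continuous_at_imp_continuous_on has_vector_derivative_continuous)
  then have "bounded (c ` ?I \<union> c' ` ?I)"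
    by (intro compact_imp_bounded compact_Un compact_continuous_image) auto
  then obtain R where R: "\<And>p. p \<in> c ` ?I \<union> c' ` ?I \<Longrightarrow> norm p \<le> R"
    unfolding bounded_iff by blast
  obtain K where K: "\<And>p u. p \<in> cball 0 R \<Longrightarrow> norm (fd Y p u) \<le> K * norm u"
    using fd_bound[OF Y compact_cball] by blast
  have lip: "norm (Y p - Y q) \<le> K * norm (p - q)" if "p \<in> cball 0 R" "q \<in> cball 0 R" for p q
  proof (rule differentiable_bound[OF convex_cball _ _ that])
    show "(Y has_derivative fd Y x) (at x within cball 0 R)" for x
      by (rule has_derivative_at_withinI[OF smooth_has_derivative[OF Y]])
    show "onorm (fd Y x) \<le> K" if "x \<in> cball 0 R" for x
      using K[OF that] by (rule onorm_le)
  qed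
  have "c T - c' T = 0"
  proof (rule gronwall_zero)
    show "((\<lambda>t. c t - c' t) has_vector_derivative Y (c t) - Y (c' t)) (at t)" for t
      by (intro has_vector_derivative_diff c c')
    show "norm (Y (c t) - Y (c' t)) \<le> K * norm (c t - c' t)" if "\<bar>t\<bar> \<le> \<bar>T\<bar>" for t
    proof -
      have "t \<in> ?I" using that by auto
      then show ?thesis by (intro lip) (auto intro!: R)
    qed
  qed (use 0 in auto)
  then show ?thesis by simp
qed

subsection \<open>Exponentials of nilpotent operators\<close>

lemma linear_funpow: "linear (B :: 'a::real_vector \<Rightarrow> 'a) \<Longrightarrow> linear (B ^^ k)"
  by (induction k) (auto simp: linear_compose[unfolded o_def] o_def linear_iff)

lemma linear_fold:
  fixes f :: "'i \<Rightarrow> 'a::real_vector \<Rightarrow> 'a"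
  assumes "\<And>j. j \<in> set xs \<Longrightarrow> linear (f j)"
  shows "linear (fold f xs)"
  using assms
proof (induction xs)
  case Nil
  then show ?case by (simp add: linear_iff)
next
  case (Cons a xs)
  then show ?case using linear_compose[of "f a" "fold f xs"] by (simp add: o_def)
qed

text \<open>The exponential series of \<open>t B\<close>, truncated after the term of order \<open>n\<close>; it is the
  exponential when \<open>B ^^ Suc n = 0\<close>.\<close>

definition nilexp :: "('a::real_vector \<Rightarrow> 'a) \<Rightarrow> nat \<Rightarrow> real \<Rightarrow> 'a \<Rightarrow> 'a"
  where "nilexp B n t y = (\<Sum>k\<le>n. (t ^ k / fact k) *\<^sub>R (B ^^ k) y)"

lemma nilexp_0 [simp]: "nilexp B n 0 y = y"
proof -
  have "nilexp B n 0 y = (\<Sum>k\<in>{0}. (0 ^ k / fact k) *\<^sub>R (B ^^ k) y)"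
    unfolding nilexp_def by (rule sum.mono_neutral_right) auto
  then show ?thesis by simp
qed

lemma linear_nilexp: "linear B \<Longrightarrow> linear (nilexp B n t)"
  unfolding nilexp_def using linear_funpow[of B]
  by (intro linear_compose_sum linear_compose_scale_right ballI) auto

lemma nilexp_commute:
  assumes "linear B" shows "nilexp B n t (B y) = B (nilexp B n t y)"
  by (simp add: nilexp_def linear_sum[OF assms] linear_scale[OF assms] funpow_swap1)

text \<open>Termwise differentiation shifts the sum by one index and loses the top term; the term
  that is missing from \<open>B (nilexp B n t y)\<close> contains \<open>B ^^ Suc n\<close>, which
  is zero.\<close>

lemma has_vector_derivative_nilexp:
  fixes B :: "'a::real_normed_vector \<Rightarrow> 'a"
  assumes B: "linear B" and nil: "\<And>y. (B ^^ Suc n) y = 0"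
  shows "((\<lambda>t. nilexp B n t y) has_vector_derivative B (nilexp B n t y)) (at t)"
proof -
  let ?c = "\<lambda>k t. real k * t ^ (k - 1) / fact k"
  have "((\<lambda>t. t ^ k / fact k) has_real_derivative ?c k t) (at t)" for k and t :: real
    by (auto intro!: derivative_eq_intros)
  then have D: "((\<lambda>t. nilexp B n t y) has_vector_derivative (\<Sum>k\<le>n. ?c k t *\<^sub>R (B ^^ k) y)) (at t)"
    unfolding nilexp_def
    by (intro has_vector_derivative_sum)
      (auto intro!: derivative_eq_intros simp: has_real_derivative_iff_has_vector_derivative)
  have "(\<Sum>k\<le>n. ?c k t *\<^sub>R (B ^^ k) y) = (\<Sum>k<n. (t ^ k / fact k) *\<^sub>R (B ^^ Suc k) y)"
    unfolding lessThan_Suc_atMost[symmetric] by (subst sum.lessThan_Suc_shift) simp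
  also have "\<dots> = (\<Sum>k\<le>n. (t ^ k / fact k) *\<^sub>R (B ^^ Suc k) y)"
    unfolding lessThan_Suc_atMost[symmetric] using nil by simp
  also have "\<dots> = B (nilexp B n t y)"
    by (simp add: nilexp_def linear_sum[OF B] linear_scale[OF B])
  finally show ?thesis using D by simp
qed

text \<open>As \<open>B\<close> commutes with its exponential, the product has derivative zero in
  \<open>t\<close> and keeps its value at \<open>0\<close>.\<close>

lemma nilexp_minus:
  fixes B :: "'a::euclidean_space \<Rightarrow> 'a"
  assumes B: "linear B" and nil: "\<And>y. (B ^^ Suc n) y = 0"
  shows "nilexp B n (- t) (nilexp B n t y) = y"
proof -
  let ?E = "nilexp B n"
  have lin: "linear (?E t)" for t by (rule linear_nilexp[OF B])
  have "((\<lambda>t. ?E (- t) (?E t y)) has_vector_derivative 0) (at t)" for t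
  proof -
    have "((\<lambda>t. ?E t z) has_derivative (\<lambda>h. h *\<^sub>R B (?E t z))) (at t)" for t z
      using has_vector_derivative_nilexp[OF B nil] by (simp add: has_vector_derivative_def)
    note D = this
    have neg: "(uminus has_derivative (\<lambda>h::real. - h)) (at t)" for t
      by (auto intro!: derivative_eq_intros)
    \<comment> \<open>Operator and argument both depend on \<open>t\<close>; in the standard basis
      their composition is a finite sum of products, which can be differentiated.\<close>
    have ex: "?E t z = (\<Sum>b\<in>Basis. (z \<bullet> b) *\<^sub>R ?E t b)" for t z
      using linear_sum[OF lin, of t "\<lambda>b. (z \<bullet> b) *\<^sub>R b" Basis]
      by (simp add: euclidean_representation linear_scale[OF lin])
    have "((\<lambda>t. \<Sum>b\<in>Basis. (?E t y \<bullet> b) *\<^sub>R ?E (- t) b) has_derivative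
       (\<lambda>h. \<Sum>b\<in>Basis. (?E t y \<bullet> b) *\<^sub>R (- h *\<^sub>R B (?E (- t) b)) + (h *\<^sub>R B (?E t y) \<bullet> b) *\<^sub>R ?E (- t) b)) (at t)"
      by (intro has_derivative_sum has_derivative_scaleR has_derivative_inner_left D
          has_derivative_compose[OF neg D])
    moreover have "(\<Sum>b\<in>Basis. (?E t y \<bullet> b) *\<^sub>R (- h *\<^sub>R B (?E (- t) b)) + (h *\<^sub>R B (?E t y) \<bullet> b) *\<^sub>R ?E (- t) b) = 0" for h
    proof -
      have "(\<Sum>b\<in>Basis. (?E t y \<bullet> b) *\<^sub>R (- h *\<^sub>R B (?E (- t) b)) + (h *\<^sub>R B (?E t y) \<bullet> b) *\<^sub>R ?E (- t) b)
        = - h *\<^sub>R B (\<Sum>b\<in>Basis. (?E t y \<bullet> b) *\<^sub>R ?E (- t) b) + h *\<^sub>R (\<Sum>b\<in>Basis. (B (?E t y) \<bullet> b) *\<^sub>R ?E (- t) b)"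
        by (simp add: sum.distrib linear_sum[OF B] linear_scale[OF B] scaleR_sum_right
            sum_negf sum_subtractf mult.commute)
      also have "\<dots> = - h *\<^sub>R B (?E (- t) (?E t y)) + h *\<^sub>R ?E (- t) (B (?E t y))"
        by (simp only: ex[symmetric])
      finally show ?thesis by (simp add: nilexp_commute[OF B])
    qed
    ultimately show ?thesis
      unfolding has_vector_derivative_def ex[of "- _", symmetric] by simp
  qed
  then obtain c where "\<And>t. ?E (- t) (?E t y) = c"
    using has_vector_derivative_zero_constant[of UNIV "\<lambda>t. ?E (- t) (?E t y)"]
    by (metis UNIV_I convex_UNIV has_vector_derivative_at_within)
  from this[of t] this[of 0] show ?thesis by simp
qed

section \<open>Expansion of products of exponentials over multi-indices\<close>

text \<open>Multiplying out the series means choosing one exponent up to \<open>n\<close> for each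
  index of the list; distinctness makes such a choice a function on \<open>set xs\<close>.\<close>

lemma fold_nilexp_expand:
  fixes B :: "'i \<Rightarrow> 'a::real_vector \<Rightarrow> 'a"
  assumes B: "\<And>j. linear (B j)" and "distinct xs"
  shows "fold (\<lambda>j. nilexp (B j) n (x j)) xs y =
    (\<Sum>\<alpha>\<in>Pi\<^sub>E (set xs) (\<lambda>_. {..n}).
      (\<Prod>j\<in>set xs. x j ^ \<alpha> j / fact (\<alpha> j)) *\<^sub>R fold (\<lambda>j. B j ^^ \<alpha> j) xs y)"
  using assms(2)
proof (induction xs arbitrary: y)
  case Nil
  then show ?case by simp
next
  case (Cons a xs)
  then have a: "a \<notin> set xs" by simp
  let ?P = "Pi\<^sub>E (set xs) (\<lambda>_. {..n})"
  define c where "c = (\<lambda>\<alpha>. \<Prod>j\<in>set xs. x j ^ \<alpha> j / fact (\<alpha> j))"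
  have lin: "linear (fold (\<lambda>j. B j ^^ \<alpha> j) xs)" for \<alpha>
    by (intro linear_fold linear_funpow B)
  have upd: "fold (\<lambda>j. B j ^^ (\<alpha>(a := k)) j) xs = fold (\<lambda>j. B j ^^ \<alpha> j) xs" for \<alpha> k
    using a by (intro ext fold_cong) auto
  have c_upd: "(\<Prod>j\<in>set xs. x j ^ (\<alpha>(a := k)) j / fact ((\<alpha>(a := k)) j)) = c \<alpha>" for \<alpha> k
    unfolding c_def using a by (intro prod.cong) auto
  have "fold (\<lambda>j. nilexp (B j) n (x j)) (a # xs) y =
      (\<Sum>\<alpha>\<in>?P. c \<alpha> *\<^sub>R fold (\<lambda>j. B j ^^ \<alpha> j) xs (nilexp (B a) n (x a) y))"
    using Cons by (simp add: c_def)
  also have "\<dots> = (\<Sum>\<alpha>\<in>?P. \<Sum>k\<le>n. ((x a ^ k / fact k) * c \<alpha>) *\<^sub>R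
      fold (\<lambda>j. B j ^^ \<alpha> j) xs ((B a ^^ k) y))"
    by (simp add: nilexp_def linear_sum[OF lin] linear_scale[OF lin] scaleR_sum_right mult.commute)
  also have "\<dots> = (\<Sum>(k, \<alpha>)\<in>{..n} \<times> ?P. ((x a ^ k / fact k) * c \<alpha>) *\<^sub>R
      fold (\<lambda>j. B j ^^ \<alpha> j) xs ((B a ^^ k) y))"
    by (subst sum.swap) (simp add: sum.cartesian_product)
  \<comment> \<open>An exponent for \<open>a\<close> and a multi-index for \<open>xs\<close> combine
    bijectively into a multi-index for \<open>a # xs\<close>, because \<open>a\<close> does not
    occur in \<open>xs\<close>.\<close>
  also have "\<dots> = (\<Sum>\<alpha>\<in>(\<lambda>(k, \<alpha>). \<alpha>(a := k)) ` ({..n} \<times> ?P).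
      (\<Prod>j\<in>set (a # xs). x j ^ \<alpha> j / fact (\<alpha> j)) *\<^sub>R fold (\<lambda>j. B j ^^ \<alpha> j) (a # xs) y)"
  proof (subst sum.reindex)
    show "inj_on (\<lambda>(k, \<alpha>). \<alpha>(a := k)) ({..n} \<times> ?P)"
      using inj_combinator[OF a, of "\<lambda>_. {..n}"] .
  qed (auto intro!: sum.cong simp: a upd c_upd fun_upd_same simp del: fun_upd_apply)
  finally show ?case by (simp add: PiE_insert_eq)
qed

subsection \<open>Left-invariant fields in exponential coordinates\<close>

lemma scaleR_fun_apply: "(c *\<^sub>R f) x = c *\<^sub>R f x"
  by (simp add: scaleR_fun_def)

text \<open>An adapted basis comes with the mere existence of a degree function; here one is fixed
  as \<open>d\<close>, so that the grading is available throughout.\<close>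

locale stratified_coordinates =
  fixes mul :: "'n::{finite,linorder} pt \<Rightarrow> 'n pt \<Rightarrow> 'n pt"
    and iv :: "'n pt \<Rightarrow> 'n pt"
    and s :: nat
    and g :: "nat \<Rightarrow> 'n vfield set"
    and X :: "'n \<Rightarrow> 'n vfield"
    and d :: "'n \<Rightarrow> nat"
  assumes lie_group: "lie_group mul iv"
    and strat: "stratification mul s g"
    and inj_X: "inj X" and indep_X: "independent (range X)"
    and span_X: "span (range X) = lie_algebra mul"
    and deg: "\<And>j. d j \<in> {1..s}" "\<And>j. X j \<in> g (d j)" "\<And>i j. i < j \<Longrightarrow> d i \<le> d j"
    and coords: "second_type_coordinates mul X"
begin

section \<open>Group laws and smoothness of translations\<close>

lemma group: "group mul 0 iv"
  using lie_group unfolding lie_group_def by blast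

lemma mul_0_left [simp]: "mul 0 x = x"
  by (rule group.group_left_neutral[OF group])

lemma iv_left [simp]: "mul (iv x) x = 0"
  by (rule group.left_inverse[OF group])

lemma mul_assoc: "mul (mul x y) z = mul x (mul y z)"
  using group by (simp add: group_def semigroup_def)

lemma mul_0_right [simp]: "mul x 0 = x"
proof -
  interpret group mul 0 iv by (rule group)
  show ?thesis by (rule right_neutral)
qed

lemma smooth_mul: "smooth (\<lambda>p. mul (fst p) (snd p))"
  using lie_group by (simp add: lie_group_def)

lemma smooth_mul_left: "smooth (mul x)"
proof -
  have "bounded_linear (\<lambda>y :: 'n pt. (0 :: 'n pt, y))"
    by (rule bounded_linear_Pair[OF bounded_linear_zero bounded_linear_ident])
  from smooth_affine[OF smooth_mul this, of "(x, 0)"] show ?thesis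
    by (simp only: fst_add snd_add fst_conv snd_conv add_0_left add_0_right)
qed

lemma smooth_mul_right: "smooth (\<lambda>y. mul y x)"
proof -
  have "bounded_linear (\<lambda>y :: 'n pt. (y, 0 :: 'n pt))"
    by (rule bounded_linear_Pair[OF bounded_linear_ident bounded_linear_zero])
  from smooth_affine[OF smooth_mul this, of "(0, x)"] show ?thesis
    by (simp only: fst_add snd_add fst_conv snd_conv add_0_left add_0_right)
qed

lemma smooth_lie_algebra: "Y \<in> lie_algebra mul \<Longrightarrow> smooth Y"
  unfolding lie_algebra_def by blast

lemma left_invariant: "Y \<in> lie_algebra mul \<Longrightarrow> Y (mul x y) = fd (mul x) y (Y y)"
  unfolding lie_algebra_def by blast

lemma X_in: "X j \<in> lie_algebra mul"
  unfolding span_X[symmetric] by (rule span_base) (rule rangeI)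

lemma subspace_lie_algebra: "subspace (lie_algebra mul)"
  unfolding span_X[symmetric] by (rule subspace_span)

section \<open>Coordinate axes as one-parameter subgroups\<close>

lemma is_exp_unique:
  assumes Y: "smooth Y" and "is_exp Y p" "is_exp Y q" shows "p = q"
proof -
  obtain c c' where
    c: "c 0 = 0" "\<And>t. (c has_vector_derivative Y (c t)) (at t)" "c 1 = p" and
    c': "c' 0 = 0" "\<And>t. (c' has_vector_derivative Y (c' t)) (at t)" "c' 1 = q"
    using assms unfolding is_exp_def by blast
  show ?thesis using integral_curve_unique[OF Y c(2) c'(2), of 1] c c' by simp
qed

lemma is_exp_zero:
  assumes p: "is_exp (0 :: 'n vfield) p" shows "p = 0"
proof -
  have "is_exp 0 (0 :: 'n pt)"
    unfolding is_exp_def by (intro exI[of _ "\<lambda>_. 0"]) auto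
  moreover have "smooth (0 :: 'n vfield)"
    by (rule smooth_lie_algebra[OF subspace_0[OF subspace_lie_algebra]])
  ultimately show ?thesis using is_exp_unique[OF _ p] by blast
qed

lemma smooth_scaleR_X: "smooth (t *\<^sub>R X j)"
  by (rule smooth_lie_algebra[OF subspace_scale[OF subspace_lie_algebra X_in]])

lemma foldr_mul_single:
  assumes "distinct xs" "\<And>i. i \<noteq> j \<Longrightarrow> p i = 0"
  shows "foldr (\<lambda>i. mul (p i)) xs 0 = (if j \<in> set xs then p j else 0)"
  using assms(1)
proof (induction xs)
  case (Cons a xs)
  then show ?case using assms(2)[of a] by (cases "a = j") auto
qed simp

text \<open>For a point of the \<open>j\<close>-th axis, all factors of the coordinate product
  except the \<open>j\<close>-th are exponentials of zero, hence the identity.\<close>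

lemma is_exp_axis: "is_exp (t *\<^sub>R X j) (axis j t)"
proof -
  obtain p where p: "\<And>i. is_exp ((axis j t $ i) *\<^sub>R X i) (p i)"
    "axis j t = foldr (\<lambda>i. mul (p i)) (rev (sorted_list_of_set UNIV)) 0"
    using coords unfolding second_type_coordinates_def by blast
  have "p i = 0" if "i \<noteq> j" for i
    using p(1)[of i] that is_exp_zero by (simp add: axis_def)
  then have "axis j t = p j"
    using p(2) foldr_mul_single[of "rev (sorted_list_of_set UNIV)" j p] by simp
  moreover have "is_exp (t *\<^sub>R X j) (p j)" using p(1)[of j] by (simp add: axis_def)
  ultimately show ?thesis by simp
qed

lemma axis_scaleR: "(axis j t :: 'n pt) = t *\<^sub>R axis j 1"
  by (simp add: axis_def vec_eq_iff)

lemma has_vector_derivative_axis: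
  "((\<lambda>t. axis j t) has_vector_derivative (axis j 1 :: 'n pt)) (at t within S)"
proof -
  have "((\<lambda>t. t *\<^sub>R axis j 1) has_vector_derivative (axis j 1 :: 'n pt)) (at t within S)"
    by (auto intro!: derivative_eq_intros)
  then show ?thesis by (simp only: axis_scaleR[symmetric])
qed

text \<open>The integral curve of \<open>X j\<close> from the identity passes at time
  \<open>t\<close> through \<open>exp (t X j)\<close>, which is \<open>axis j t\<close>; so this
  curve is the \<open>j\<close>-th axis, run through at unit speed.\<close>

lemma X_axis: "X j (axis j t) = axis j 1"
proof -
  obtain c where c: "c 0 = 0" "\<And>t. (c has_vector_derivative X j (c t)) (at t)"
    using is_exp_axis[of 1 j] unfolding is_exp_def by auto
  have "c t = axis j t" for t
  proof -
    \<comment> \<open>Rescaling time by \<open>t\<close> gives an integral curve of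
      \<open>t *\<^sub>R X j\<close> whose time-one value is \<open>c t\<close>.\<close>
    have "((\<lambda>\<tau>. c (t * \<tau>)) has_vector_derivative (t *\<^sub>R X j) (c (t * \<tau>))) (at \<tau>)" for \<tau>
    proof -
      have "((\<lambda>\<tau>. t * \<tau>) has_vector_derivative t) (at \<tau>)"
        by (auto intro!: derivative_eq_intros)
      from vector_diff_chain_at[OF this c(2)] show ?thesis by (simp add: o_def scaleR_fun_def)
    qed
    then have "is_exp (t *\<^sub>R X j) (c t)"
      unfolding is_exp_def using c(1) by (intro exI[of _ "\<lambda>\<tau>. c (t * \<tau>)"]) auto
    then show ?thesis using is_exp_unique[OF smooth_scaleR_X] is_exp_axis by blast
  qed
  then have "c = axis j" by blast
  then have "((\<lambda>t. axis j t) has_vector_derivative X j (axis j t)) (at t)" using c(2) by simp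
  then show ?thesis using has_vector_derivative_axis vector_derivative_unique_at by blast
qed

lemma coordinate_product:
  "foldr (\<lambda>j. mul (axis j (x $ j))) (rev (sorted_list_of_set UNIV)) 0 = x"
proof -
  obtain p where p: "\<And>i. is_exp ((x $ i) *\<^sub>R X i) (p i)"
    "x = foldr (\<lambda>i. mul (p i)) (rev (sorted_list_of_set UNIV)) 0"
    using coords unfolding second_type_coordinates_def by blast
  have eq: "p i = axis i (x $ i)" for i
    using is_exp_unique[OF smooth_scaleR_X p(1) is_exp_axis] .
  show ?thesis by (rule p(2)[symmetric, unfolded eq])
qed

section \<open>Left-invariant fields parametrised by their value at the origin\<close>

text \<open>The left-invariant field with value \<open>y\<close> at the origin. This identifies the
  Lie algebra with its coordinate space for the basis \<open>X\<close>, so that the linear algebra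
  takes place in \<open>'n pt\<close>.\<close>

definition V :: "'n pt \<Rightarrow> 'n vfield"
  where "V y = (\<Sum>k\<in>UNIV. (y $ k) *\<^sub>R X k)"

lemma sum_fun_apply: "(\<Sum>k\<in>A. f k :: 'n vfield) x = (\<Sum>k\<in>A. f k x)"
  by (induction A rule: infinite_finite_induct) auto

lemma V_apply: "V y x = (\<Sum>k\<in>UNIV. (y $ k) *\<^sub>R X k x)"
  by (simp add: V_def sum_fun_apply scaleR_fun_def)

lemma linear_V: "linear V"
  by (rule linearI) (simp_all add: V_def scaleR_add_left sum.distrib scaleR_sum_right)

lemma linear_V_apply: "linear (\<lambda>y. V y x)"
  by (rule linearI) (simp_all add: V_apply scaleR_add_left sum.distrib scaleR_sum_right)

lemma sum_axis: "(\<Sum>k\<in>UNIV. (y $ k) *\<^sub>R axis k 1) = (y :: 'n pt)"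
  using basis_expansion[of y] by (simp add: scalar_mult_eq_scaleR)

lemma X_0: "X k 0 = axis k 1"
  using X_axis[of k 0] axis_scaleR[of k 0] by simp

lemma V_0 [simp]: "V y 0 = y"
  by (simp add: V_apply X_0 sum_axis)

lemma V_axis [simp]: "V (axis j 1) = X j"
proof -
  have "(axis j 1 $ k) *\<^sub>R X k = (if k = j then X j else 0)" for k by (simp add: axis_def)
  then show ?thesis by (simp add: V_def)
qed

lemma V_in: "V y \<in> lie_algebra mul"
  unfolding V_def by (intro subspace_sum subspace_scale subspace_lie_algebra X_in)

lemmas smooth_V = smooth_lie_algebra[OF V_in]
lemmas left_invariant_V = left_invariant[OF V_in]

lemma left_invariant_0: "Y \<in> lie_algebra mul \<Longrightarrow> Y x = fd (mul x) 0 (Y 0)"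
  using left_invariant[of Y x 0] by (simp only: mul_0_right)

lemma V_eqI:
  assumes "\<And>x. Y x = fd (mul x) 0 (Y 0)" shows "Y = V (Y 0)"
proof
  fix x
  have "V (Y 0) x = fd (mul x) 0 (V (Y 0) 0)" by (rule left_invariant_0[OF V_in])
  then show "Y x = V (Y 0) x" using assms[of x] V_0 by metis
qed

lemma lie_algebra_V: "Y \<in> lie_algebra mul \<Longrightarrow> Y = V (Y 0)"
  by (rule V_eqI) (rule left_invariant_0)

text \<open>Left translation by \<open>iv x\<close> carries the value of the field at
  \<open>x\<close> to its value \<open>y\<close> at the identity.\<close>

lemma V_eq_0_iff: "V y x = 0 \<longleftrightarrow> y = 0"
proof
  assume "V y x = 0"
  then have "fd (mul (iv x)) x (V y x) = 0"
    using linear_0[OF linear_fd[OF smooth_mul_left]] by simp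
  then show "y = 0"
    using left_invariant_V[of y "iv x" x] by simp
qed (simp add: linear_0[OF linear_V_apply])

lemma V_inject: "V y x = V z x \<Longrightarrow> y = z"
  using V_eq_0_iff[of "y - z" x] linear_diff[OF linear_V_apply, of y z x] by simp

lemma representation_V: "representation (range X) (V y) (X k) = y $ k"
proof -
  have R: "representation (range X) (X j) (X k) = axis j 1 $ k" for j
    using representation_basis[OF indep_X, of "X j"] inj_X by (auto simp: axis_def inj_eq)
  have "representation (range X) (V y) (X k) =
      (\<Sum>j\<in>UNIV. representation (range X) ((y $ j) *\<^sub>R X j) (X k))"
    unfolding V_def by (subst representation_sum[OF indep_X]) (auto intro: span_scale span_base)
  also have "\<dots> = (\<Sum>j\<in>UNIV. y $ j * axis j 1 $ k)"
    by (simp add: representation_scale[OF indep_X] span_base R)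
  also have "\<dots> = y $ k" by (simp add: axis_def if_distrib cong: if_cong)
  finally show ?thesis .
qed

section \<open>Structure constants and iterated brackets in coordinates\<close>

definition br :: "'n pt \<Rightarrow> 'n pt \<Rightarrow> 'n pt"
  where "br y z = lie_bracket (V y) (V z) 0"

lemma V_br: "V (br y z) = lie_bracket (V y) (V z)"
  unfolding br_def
proof (rule V_eqI[symmetric])
  fix x
  show "lie_bracket (V y) (V z) x = fd (mul x) 0 (lie_bracket (V y) (V z) 0)"
    using lie_bracket_related[OF smooth_mul_left smooth_V smooth_V smooth_V smooth_V
        left_invariant_V left_invariant_V, of y z x 0] by simp
qed

lemma linear_br_left: "linear (\<lambda>y. br y z)"
  by (rule linearI)
    (simp_all add: br_def linear_add[OF linear_V] linear_scale[OF linear_V] lie_bracket_add_left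
      lie_bracket_scaleR_left smooth_V scaleR_fun_apply)

lemma struct_const_br: "struct_const X i j k = br (axis i 1) (axis j 1) $ k"
  unfolding struct_const_def using representation_V[of "br (axis i 1) (axis j 1)" k] by (simp add: V_br)

text \<open>The matrix of \<open>- ad (X j)\<close>, since extremal polynomials bracket on the
  right. Hence \<open>e^(t B j)\<close> is the matrix of the inverse of
  \<open>Ad (exp (t X j))\<close>.\<close>

definition B :: "'n \<Rightarrow> 'n pt \<Rightarrow> 'n pt"
  where "B j y = br y (axis j 1)"

lemma linear_B: "linear (B j)"
  unfolding B_def by (rule linear_br_left)

lemma V_B: "V (B j y) = lie_bracket (V y) (X j)"
  by (simp add: B_def V_br)

lemma funpow_bracket: "((\<lambda>Y. lie_bracket Y (X j)) ^^ k) (V y) = V ((B j ^^ k) y)"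
  by (induction k) (simp_all add: V_B)

lemma fold_bracket:
  "fold (\<lambda>j. (\<lambda>Y. lie_bracket Y (X j)) ^^ \<alpha> j) xs (V y) = V (fold (\<lambda>j. B j ^^ \<alpha> j) xs y)"
  by (induction xs arbitrary: y) (simp_all add: funpow_bracket)

lemma gen_struct_const_fold:
  "gen_struct_const X i \<alpha> k = fold (\<lambda>j. B j ^^ \<alpha> j) (sorted_list_of_set UNIV) (axis i 1) $ k"
  unfolding gen_struct_const_def iterated_bracket_def
  using fold_bracket[of \<alpha> "sorted_list_of_set UNIV" "axis i 1"] by (simp add: representation_V)

section \<open>Grading of the Lie algebra and degrees of brackets\<close>

lemma g_zero: "s < i \<Longrightarrow> g i = {0}"
  using strat unfolding stratification_def by blast

lemma g_step: "2 \<le> i \<Longrightarrow> g i = bracket_span (g (i - 1)) (g 1)"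
  using strat unfolding stratification_def by blast

lemma subspace_g:
  assumes "1 \<le> i" shows "subspace (g i)"
proof (cases "i \<le> s")
  case True
  then show ?thesis using strat assms unfolding stratification_def by auto
next
  case False
  then show ?thesis by (simp add: g_zero)
qed

lemma g_sub:
  assumes "1 \<le> i" shows "g i \<subseteq> lie_algebra mul"
proof (cases "i \<le> s")
  case True
  then show ?thesis using strat assms unfolding stratification_def by auto
next
  case False
  then show ?thesis using subspace_0[OF subspace_lie_algebra] by (simp add: g_zero)
qed

text \<open>\<open>V y\<close> decomposes into layers in two ways: concentrated in layer
  \<open>m\<close>, and by grouping its basis expansion by degree. As the sum of the layers is
  direct, both agree, which excludes coefficients of other degrees.\<close>

lemma g_coeff:
  assumes m: "1 \<le> m" "m \<le> s" and y: "V y \<in> g m" and k: "y $ k \<noteq> 0"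
  shows "d k = m"
proof (rule ccontr)
  assume km: "d k \<noteq> m"
  define f1 where "f1 = (\<lambda>i. if i = m then V y else 0)"
  define f2 where "f2 = (\<lambda>i. \<Sum>k | d k = i. (y $ k) *\<^sub>R X k)"
  have ex1: "\<exists>!f. (\<forall>i\<in>{1..s}. f i \<in> g i) \<and> (\<forall>i. i \<notin> {1..s} \<longrightarrow> f i = 0) \<and>
        V y = (\<Sum>i\<in>{1..s}. f i)"
    using strat[unfolded stratification_def, THEN conjunct2, THEN conjunct1] V_in by (rule bspec)
  have P1: "(\<forall>i\<in>{1..s}. f1 i \<in> g i) \<and> (\<forall>i. i \<notin> {1..s} \<longrightarrow> f1 i = 0) \<and> V y = (\<Sum>i\<in>{1..s}. f1 i)"
    using m y subspace_0[OF subspace_g] by (auto simp: f1_def)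
  have P2: "(\<forall>i\<in>{1..s}. f2 i \<in> g i) \<and> (\<forall>i. i \<notin> {1..s} \<longrightarrow> f2 i = 0) \<and> V y = (\<Sum>i\<in>{1..s}. f2 i)"
  proof (intro conjI ballI allI impI)
    show "f2 i \<in> g i" if "i \<in> {1..s}" for i
      unfolding f2_def using that deg(2) by (auto intro!: subspace_sum subspace_scale subspace_g)
    show "f2 i = 0" if "i \<notin> {1..s}" for i
      using that deg(1) unfolding f2_def by (intro sum.neutral) auto
    show "V y = (\<Sum>i\<in>{1..s}. f2 i)"
      unfolding V_def f2_def using deg(1)
      by (subst sum.group[of UNIV "{1..s}" d, symmetric]) auto
  qed
  have "f1 = f2" using ex1 P1 P2 by blast
  then have "f2 (d k) = 0" using km by (auto simp: f1_def dest: fun_cong[of _ _ "d k"])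
  \<comment> \<open>At the origin the basis fields are the coordinate vectors, so the
    \<open>k\<close>-th component of this layer is the coefficient \<open>y $ k\<close>.\<close>
  then have "f2 (d k) 0 $ k = 0" by simp
  moreover have "f2 (d k) 0 = (\<Sum>l | d l = d k. (y $ l) *\<^sub>R axis l 1)"
    unfolding f2_def sum_fun_apply scaleR_fun_def X_0 ..
  moreover have "(\<Sum>l | d l = d k. (y $ l) *\<^sub>R axis l 1) $ k = (\<Sum>l\<in>{k}. y $ l)"
    unfolding sum_component by (rule sum.mono_neutral_cong_right) (auto simp: axis_def)
  ultimately show False using k by simp
qed

text \<open>Allows an inclusion of brackets to be checked on generators. \<open>Z\<close> is
  confined to the Lie algebra because additivity of the bracket is available for smooth
  fields.\<close>

lemma subspace_bracket:
  assumes "Y \<in> lie_algebra mul" "subspace T"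
  shows "subspace {Z \<in> lie_algebra mul. lie_bracket Y Z \<in> T}"
proof -
  have s: "lie_bracket Y (Z + Z') = lie_bracket Y Z + lie_bracket Y Z'"
      "lie_bracket Y (c *\<^sub>R Z) = c *\<^sub>R lie_bracket Y Z"
    if "Z \<in> lie_algebra mul" "Z' \<in> lie_algebra mul" for Z Z' c
    using that assms smooth_lie_algebra lie_bracket_add_left[of Z Z' Y] lie_bracket_scaleR_left[of Z Y c]
      lie_bracket_swap[of Y] by auto
  have "lie_bracket Y 0 = 0"
    using s(2)[of 0 0 0] subspace_0[OF subspace_lie_algebra] by simp
  then show ?thesis
    using subspace_lie_algebra assms(2) s unfolding subspace_def by auto
qed

lemma bracket_g1: "1 \<le> k \<Longrightarrow> Y \<in> g k \<Longrightarrow> Z \<in> g 1 \<Longrightarrow> lie_bracket Y Z \<in> g (Suc k)"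
  using g_step[of "Suc k"] by (auto simp: bracket_span_def intro: span_base)

text \<open>Layer \<open>j + 1\<close> is spanned by brackets \<open>[A, C]\<close> with
  \<open>C\<close> in \<open>g 1\<close>, and Jacobi gives
  \<open>[Y, [A, C]] = [[Y, A], C] - [[Y, C], A]\<close>. The last term uses the induction
  hypothesis with \<open>i + 1\<close> in place of \<open>i\<close>, hence the generalisation over
  \<open>i\<close>.\<close>

lemma bracket_g:
  assumes "1 \<le> i" "1 \<le> j" "Y \<in> g i" "Z \<in> g j"
  shows "lie_bracket Y Z \<in> g (i + j)"
  using assms(2,1,3,4)
proof (induction j arbitrary: i Y Z rule: nat_induct_at_least)
  case base
  then show ?case using bracket_g1 by simp
next
  case (Suc j)
  have Y: "Y \<in> lie_algebra mul" using Suc.prems g_sub by blast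
  let ?T = "{Z \<in> lie_algebra mul. lie_bracket Y Z \<in> g (i + Suc j)}"
  have "Z \<in> span {lie_bracket A C |A C. A \<in> g j \<and> C \<in> g 1}"
    using Suc g_step[of "Suc j"] by (simp add: bracket_span_def)
  moreover have "span {lie_bracket A C |A C. A \<in> g j \<and> C \<in> g 1} \<subseteq> ?T"
  proof (rule span_minimal)
    show "subspace ?T" by (rule subspace_bracket[OF Y subspace_g]) simp
    show "{lie_bracket A C |A C. A \<in> g j \<and> C \<in> g 1} \<subseteq> ?T"
    proof
      fix W assume "W \<in> {lie_bracket A C |A C. A \<in> g j \<and> C \<in> g 1}"
      then obtain A C where W: "W = lie_bracket A C" and A: "A \<in> g j" and C: "C \<in> g 1" by blast
      have AC: "A \<in> lie_algebra mul" "C \<in> lie_algebra mul"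
        using A C g_sub[of j] g_sub[of 1] Suc.hyps by auto
      have "W \<in> lie_algebra mul"
        using bracket_g1[OF Suc.hyps A C] g_sub[of "Suc j"] W by auto
      moreover have "lie_bracket (lie_bracket Y A) C \<in> g (Suc (i + j))"
        using Suc.prems A C by (intro bracket_g1 Suc.IH) auto
      moreover have "lie_bracket (lie_bracket Y C) A \<in> g (Suc i + j)"
        using Suc.prems A C by (intro bracket_g1 Suc.IH) auto
      moreover have "lie_bracket Y W =
          lie_bracket (lie_bracket Y A) C - lie_bracket (lie_bracket Y C) A"
        using lie_bracket_jacobi[OF smooth_lie_algebra smooth_lie_algebra smooth_lie_algebra, OF Y AC]
          lie_bracket_swap[of A "lie_bracket Y C"] unfolding W by simp
      ultimately show "W \<in> ?T"
        using subspace_diff[OF subspace_g[of "Suc (i + j)"]] by simp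
    qed
  qed
  ultimately show ?case by blast
qed

text \<open>The bracket lies in layer \<open>d i + d j\<close>. A nonzero coefficient shows that
  this layer is at most \<open>s\<close>, as later layers are zero, and then \<open>g_coeff\<close>
  applies.\<close>

lemma br_degree:
  assumes "br (axis i 1) (axis j 1) $ k \<noteq> 0"
  shows "d k = d i + d j"
proof -
  have i: "1 \<le> d i" "1 \<le> d j" using deg(1) by auto
  have *: "V (br (axis i 1) (axis j 1)) \<in> g (d i + d j)"
    using bracket_g[OF i deg(2) deg(2)] by (simp add: V_br)
  have "d i + d j \<le> s"
  proof (rule ccontr)
    assume "\<not> d i + d j \<le> s"
    then have "V (br (axis i 1) (axis j 1)) = 0" using * g_zero by auto
    then have "br (axis i 1) (axis j 1) = 0" using V_0 by (metis zero_fun_apply)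
    then show False using assms by simp
  qed
  then show ?thesis using g_coeff[OF _ _ * assms] i by simp
qed

section \<open>Filtration by degree and nilpotency\<close>

text \<open>The coordinates of fields of degree at least \<open>m\<close>: everything for
  \<open>m = 1\<close>, and zero once \<open>m > s\<close>.\<close>

definition F :: "nat \<Rightarrow> 'n pt set"
  where "F m = {y. \<forall>k. y $ k \<noteq> 0 \<longrightarrow> m \<le> d k}"

lemma subspace_F: "subspace (F m)"
  unfolding subspace_def F_def by (auto simp: ) (metis add_0)

lemma F_1: "y \<in> F 1"
  using deg(1) by (auto simp: F_def)

lemma F_top: "s < m \<Longrightarrow> y \<in> F m \<Longrightarrow> y = 0"
  using deg(1) unfolding F_def vec_eq_iff by (metis (mono_tags, lifting) atLeastAtMost_iff
      le_less_trans mem_Collect_eq not_less zero_index)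

lemma F_mono: "m \<le> m' \<Longrightarrow> F m' \<subseteq> F m"
  by (force simp: F_def)

lemma B_F:
  assumes "y \<in> F m" shows "B j y \<in> F (Suc m)"
proof -
  have "B j y = (\<Sum>k\<in>UNIV. (y $ k) *\<^sub>R B j (axis k 1))"
    by (subst (1) sum_axis[of y, symmetric])
      (simp add: linear_sum[OF linear_B] linear_scale[OF linear_B])
  also have "\<dots> \<in> F (Suc m)"
  proof (intro subspace_sum subspace_F)
    fix k
    show "(y $ k) *\<^sub>R B j (axis k 1) \<in> F (Suc m)"
    proof (cases "y $ k = 0")
      case False
      then have "m \<le> d k" using assms by (simp add: F_def)
      then have "B j (axis k 1) \<in> F (Suc m)"
        using br_degree deg(1)[of j] by (fastforce simp: F_def B_def)
      then show ?thesis by (rule subspace_scale[OF subspace_F])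
    qed (simp add: subspace_0[OF subspace_F])
  qed
  finally show ?thesis .
qed

lemma funpow_B_F: "y \<in> F m \<Longrightarrow> (B j ^^ k) y \<in> F (m + k)"
  by (induction k) (auto intro: B_F)

text \<open>Each bracket raises the filtration by one, so \<open>s + 1\<close> of them lead from
  \<open>F 1\<close> into \<open>F (s + 2)\<close>, which is zero.\<close>

lemma B_nilpotent: "(B j ^^ Suc s) y = 0"
  using funpow_B_F[OF F_1] F_top[of "1 + Suc s"] by fastforce

subsection \<open>The adjoint representation\<close>

abbreviation E :: "'n \<Rightarrow> real \<Rightarrow> 'n pt \<Rightarrow> 'n pt"
  where "E j \<equiv> nilexp (B j) s"

lemmas linear_E = linear_nilexp[OF linear_B]

lemma E_minus [simp]: "E j (- t) (E j t y) = y" "E j t (E j (- t) y) = y"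
  using nilexp_minus[OF linear_B B_nilpotent, of j t y]
    nilexp_minus[OF linear_B B_nilpotent, of j "- t" y] by simp_all

section \<open>Right translations and the operators they induce\<close>

text \<open>As a partial derivative of the multiplication on the product space, the derivative of a
  right translation can itself be differentiated in \<open>q\<close>.\<close>

lemma fd_mul_right: "fd (\<lambda>w. mul w q) z y = fd (\<lambda>p. mul (fst p) (snd p)) (z, q) (y, 0)"
proof -
  have "((\<lambda>w. (w, q)) has_derivative (\<lambda>h. (h, 0))) (at z)"
    by (auto intro!: derivative_eq_intros)
  from has_derivative_compose[OF this smooth_has_derivative[OF smooth_mul]]
  have "((\<lambda>w. mul w q) has_derivative (\<lambda>h. fd (\<lambda>p. mul (fst p) (snd p)) (z, q) (h, 0))) (at z)"
    by (simp only: fst_conv snd_conv)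
  from fd_eqI[OF this] show ?thesis by (rule fun_cong)
qed

lemma fd_mul_left: "fd (mul x) z y = fd (\<lambda>p. mul (fst p) (snd p)) (x, z) (0, y)"
proof -
  have "((\<lambda>w. (x, w)) has_derivative (\<lambda>h. (0, h))) (at z)"
    by (auto intro!: derivative_eq_intros)
  from has_derivative_compose[OF this smooth_has_derivative[OF smooth_mul]]
  have "((\<lambda>w. mul x w) has_derivative (\<lambda>h. fd (\<lambda>p. mul (fst p) (snd p)) (x, z) (0, h))) (at z)"
    by (simp only: fst_conv snd_conv)
  from fd_eqI[OF this] show ?thesis by (rule fun_cong)
qed

lemma axis_0 [simp]: "(axis j 0 :: 'n pt) = 0"
  by (simp add: axis_def vec_eq_iff)

lemma has_derivative_axis: "((\<lambda>t. axis j t) has_derivative (\<lambda>h. h *\<^sub>R (axis j 1 :: 'n pt))) (at t)"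
  using has_vector_derivative_axis[of j t UNIV] unfolding has_vector_derivative_def .

text \<open>The operator \<open>T\<close> is \<open>Ad(q)\<^sup>-\<^sup>1\<close> in the basis \<open>X\<close>.\<close>

definition right_related :: "'n pt \<Rightarrow> ('n pt \<Rightarrow> 'n pt) \<Rightarrow> bool"
  where "right_related q T \<longleftrightarrow> (\<forall>y z. fd (\<lambda>w. mul w q) z (V y z) = V (T y) (mul z q))"

text \<open>Right translation by \<open>q\<close> commutes with left translation by
  \<open>z\<close>, so left invariance carries the relation from the identity to
  \<open>z\<close>.\<close>

lemma right_relatedI:
  assumes "\<And>y. fd (\<lambda>w. mul w q) 0 y = V (T y) q" shows "right_related q T"
  unfolding right_related_def
proof (intro allI)
  fix y z
  have l: "((mul x) has_derivative fd (mul x) w) (at w)" for x w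
    by (rule smooth_has_derivative[OF smooth_mul_left])
  have r: "((\<lambda>w. mul w q) has_derivative fd (\<lambda>w. mul w q) w) (at w)" for w
    by (rule smooth_has_derivative[OF smooth_mul_right])
  \<comment> \<open>The map sending \<open>w\<close> to \<open>z w q\<close> is differentiated at
    the identity in two ways, according to the bracketing.\<close>
  have "((\<lambda>w. mul (mul z w) q) has_derivative (\<lambda>h. fd (\<lambda>w. mul w q) (mul z 0) (fd (mul z) 0 h))) (at 0)"
    by (rule has_derivative_compose[OF l r])
  moreover have "((\<lambda>w. mul z (mul w q)) has_derivative (\<lambda>h. fd (mul z) (mul 0 q) (fd (\<lambda>w. mul w q) 0 h))) (at 0)"
    by (rule has_derivative_compose[OF r l])
  ultimately have "(\<lambda>h. fd (\<lambda>w. mul w q) (mul z 0) (fd (mul z) 0 h)) =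
      (\<lambda>h. fd (mul z) (mul 0 q) (fd (\<lambda>w. mul w q) 0 h))"
    unfolding mul_assoc by (rule has_derivative_unique)
  from fun_cong[OF this, of y]
  have "fd (\<lambda>w. mul w q) z (fd (mul z) 0 y) = fd (mul z) q (V (T y) q)"
    by (simp only: mul_0_left mul_0_right assms)
  then show "fd (\<lambda>w. mul w q) z (V y z) = V (T y) (mul z q)"
    using left_invariant_0[OF V_in, of y z] left_invariant_V[of "T y" z q] by (simp only: V_0)
qed

text \<open>Right translation by \<open>mul q q'\<close> is translation by \<open>q\<close> followed
  by translation by \<open>q'\<close>; thus \<open>T\<close> acts first, as for inverses of
  \<open>Ad\<close>.\<close>

lemma right_related_mul:
  assumes "right_related q T" "right_related q' T'"
  shows "right_related (mul q q') (\<lambda>y. T' (T y))"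
  unfolding right_related_def
proof (intro allI)
  fix y z
  have r: "((\<lambda>w. mul w q) has_derivative fd (\<lambda>w. mul w q) w) (at w)" for q w
    by (rule smooth_has_derivative[OF smooth_mul_right])
  have "((\<lambda>w. mul w (mul q q')) has_derivative (\<lambda>h. fd (\<lambda>w. mul w q') (mul z q) (fd (\<lambda>w. mul w q) z h))) (at z)"
    unfolding mul_assoc[symmetric] by (rule has_derivative_compose[OF r r])
  from fun_cong[OF fd_eqI[OF this], of "V y z"]
  show "fd (\<lambda>w. mul w (mul q q')) z (V y z) = V (T' (T y)) (mul z (mul q q'))"
    using assms unfolding right_related_def by (simp add: mul_assoc)
qed

lemma right_related_unique:
  assumes "right_related q T" "right_related q T'" shows "T y = T' y"
  using assms V_inject[of "T y" "mul 0 q" "T' y"] unfolding right_related_def by metis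

lemma right_related_0: "right_related 0 (\<lambda>y. y)"
  unfolding right_related_def using fd_eqI[OF has_derivative_ident] by simp

lemma fd_V: "fd (V y) x u = (\<Sum>k\<in>UNIV. (y $ k) *\<^sub>R fd (X k) x u)"
proof -
  have "((\<lambda>x. \<Sum>k\<in>UNIV. (y $ k) *\<^sub>R X k x) has_derivative
      (\<lambda>u. \<Sum>k\<in>UNIV. (y $ k) *\<^sub>R fd (X k) x u)) (at x)"
    by (intro has_derivative_sum has_derivative_scaleR_right smooth_has_derivative smooth_lie_algebra X_in)
  then have "(V y has_derivative (\<lambda>u. \<Sum>k\<in>UNIV. (y $ k) *\<^sub>R fd (X k) x u)) (at x)"
    unfolding V_apply[symmetric] .
  from fun_cong[OF fd_eqI[OF this]] show ?thesis .
qed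

text \<open>Both sides of the relation solve the variational equation of \<open>X j\<close> along \<open>t \<mapsto> exp (t X j)\<close>.\<close>

lemma right_related_axis: "right_related (axis j T) (E j T)"
proof (rule right_relatedI)
  fix y
  let ?m = "\<lambda>p. mul (fst p) (snd p)"
  let ?e = "axis j 1 :: 'n pt"
  define u where "u = (\<lambda>t. fd (\<lambda>w. mul w (axis j t)) 0 y)"
  define w where "w = (\<lambda>t. V (E j t y) (axis j t))"
  have u: "(u has_vector_derivative fd (X j) (axis j t) (u t)) (at t)" for t
  proof -
    have a: "((\<lambda>t. (0 :: 'n pt, axis j t)) has_derivative (\<lambda>h. (0, h *\<^sub>R ?e))) (at t)"
      by (intro has_derivative_Pair has_derivative_const has_derivative_axis)
    have "(u has_derivative (\<lambda>h. fd (\<lambda>p. fd ?m p (y, 0)) (0, axis j t) (0, h *\<^sub>R ?e)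
        + fd ?m (0, axis j t) 0)) (at t)"
      unfolding u_def fd_mul_right
      by (rule has_derivative_fd[OF smooth_mul a has_derivative_const])
    moreover have "fd (\<lambda>p. fd ?m p (y, 0)) (0, axis j t) (0, h *\<^sub>R ?e) + fd ?m (0, axis j t) 0 =
        h *\<^sub>R fd (\<lambda>p. fd ?m p (y, 0)) (0, axis j t) (0, ?e)" for h
      using linear_0[OF linear_fd[OF smooth_mul]]
        linear_scale[OF linear_fd[OF smooth_fd[OF smooth_mul]], of _ _ h "(0, ?e)"] by simp
    ultimately have 1: "(u has_vector_derivative fd (\<lambda>p. fd ?m p (y, 0)) (0, axis j t) (0, ?e)) (at t)"
      by (simp add: has_vector_derivative_def)
    have b: "((\<lambda>z. (z, axis j t)) has_derivative (\<lambda>h. (h, 0 :: 'n pt))) (at 0)"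
      by (intro has_derivative_Pair has_derivative_const has_derivative_ident)
    \<comment> \<open>The axis being an integral curve, \<open>X j\<close> at
      \<open>mul z (axis j t)\<close> is the derivative of the multiplication in \<open>t\<close>.
      Differentiating this in \<open>z\<close> and exchanging the order of the derivatives gives the
      equation for \<open>u\<close>.\<close>
    have "X j (mul z (axis j t)) = fd ?m (z, axis j t) (0, ?e)" for z
      unfolding left_invariant[OF X_in] X_axis by (rule fd_mul_left)
    then have "((\<lambda>z. X j (mul z (axis j t))) has_derivative (\<lambda>h. fd (\<lambda>p. fd ?m p (0, ?e)) (0, axis j t) (h, 0)
        + fd ?m (0, axis j t) 0)) (at 0)"
      using has_derivative_fd[OF smooth_mul b has_derivative_const, of "(0, ?e)"] by simp
    moreover have "((\<lambda>z. X j (mul z (axis j t))) has_derivative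
        (\<lambda>h. fd (X j) (mul 0 (axis j t)) (fd (\<lambda>w. mul w (axis j t)) 0 h))) (at 0)"
      by (rule has_derivative_compose[OF smooth_has_derivative[OF smooth_mul_right]
            smooth_has_derivative[OF smooth_lie_algebra[OF X_in]]])
    ultimately have "(\<lambda>h. fd (\<lambda>p. fd ?m p (0, ?e)) (0, axis j t) (h, 0) + fd ?m (0, axis j t) 0) =
        (\<lambda>h. fd (X j) (mul 0 (axis j t)) (fd (\<lambda>w. mul w (axis j t)) 0 h))"
      by (rule has_derivative_unique)
    from fun_cong[OF this, of y]
    have "fd (\<lambda>p. fd ?m p (0, ?e)) (0, axis j t) (y, 0) = fd (X j) (axis j t) (u t)"
      using linear_0[OF linear_fd[OF smooth_mul]] by (simp add: u_def)
    then show ?thesis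
      using 1 second_derivative_symmetric[OF smooth_mul, of "(y, 0)" "(0, axis j t)" "(0, ?e)"] by simp
  qed
  have w: "(w has_vector_derivative fd (X j) (axis j t) (w t)) (at t)" for t
  proof -
    let ?f = "E j t y"
    have f: "((\<lambda>t. E j t y) has_derivative (\<lambda>h. h *\<^sub>R B j ?f)) (at t)"
      using has_vector_derivative_nilexp[OF linear_B B_nilpotent] unfolding has_vector_derivative_def .
    have "(w has_derivative (\<lambda>h. \<Sum>k\<in>UNIV. (?f $ k) *\<^sub>R fd (X k) (axis j t) (h *\<^sub>R ?e)
        + ((h *\<^sub>R B j ?f) $ k) *\<^sub>R X k (axis j t))) (at t)"
      unfolding w_def V_apply
      by (intro has_derivative_sum has_derivative_scaleR bounded_linear.has_derivative[OF bounded_linear_vec_nth f]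
          has_derivative_compose[OF has_derivative_axis smooth_has_derivative[OF smooth_lie_algebra[OF X_in]]])
    moreover have "(\<Sum>k\<in>UNIV. (?f $ k) *\<^sub>R fd (X k) (axis j t) (h *\<^sub>R ?e)
        + ((h *\<^sub>R B j ?f) $ k) *\<^sub>R X k (axis j t)) = h *\<^sub>R fd (X j) (axis j t) (w t)" for h
    proof -
      have "(\<Sum>k\<in>UNIV. (?f $ k) *\<^sub>R fd (X k) (axis j t) (h *\<^sub>R ?e)
        + ((h *\<^sub>R B j ?f) $ k) *\<^sub>R X k (axis j t)) =
        h *\<^sub>R (fd (V ?f) (axis j t) ?e + V (B j ?f) (axis j t))"
        by (simp add: sum.distrib fd_V V_apply linear_scale[OF linear_fd[OF smooth_lie_algebra[OF X_in]]]
            scaleR_add_right scaleR_sum_right mult.commute)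
      \<comment> \<open>The bracket of \<open>V ?f\<close> with \<open>X j\<close> trades the
        derivative of \<open>V ?f\<close> along \<open>X j\<close> for that of \<open>X j\<close>
        along \<open>V ?f\<close>.\<close>
      also have "fd (V ?f) (axis j t) ?e + V (B j ?f) (axis j t) = fd (X j) (axis j t) (w t)"
        by (simp add: V_B lie_bracket_def X_axis w_def)
      finally show ?thesis .
    qed
    ultimately show ?thesis by (simp add: has_vector_derivative_def)
  qed
  have "continuous_on {- \<bar>T\<bar>..\<bar>T\<bar>} (\<lambda>t. axis j t :: 'n pt)"
    using has_vector_derivative_axis by (intro continuous_at_imp_continuous_on ballI)
      (blast intro: has_vector_derivative_continuous)
  then have "compact ((\<lambda>t. axis j t :: 'n pt) ` {- \<bar>T\<bar>..\<bar>T\<bar>})"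
    by (rule compact_continuous_image) simp
  from fd_bound[OF smooth_lie_algebra[OF X_in] this] obtain K
    where K: "\<And>t v. t \<in> {- \<bar>T\<bar>..\<bar>T\<bar>} \<Longrightarrow> norm (fd (X j) (axis j t) v) \<le> K * norm v"
    by blast
  have "u T - w T = 0"
  proof (rule gronwall_zero)
    show "((\<lambda>t. u t - w t) has_vector_derivative fd (X j) (axis j t) (u t - w t)) (at t)" for t
      using has_vector_derivative_diff[OF u w] linear_diff[OF linear_fd[OF smooth_lie_algebra[OF X_in]]] by simp
    show "u 0 - w 0 = 0"
      using fd_eqI[OF has_derivative_ident] by (simp add: u_def w_def)
    show "norm (fd (X j) (axis j t) (u t - w t)) \<le> K * norm (u t - w t)" if "\<bar>t\<bar> \<le> \<bar>T\<bar>" for t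
    proof -
      have "t \<in> {- \<bar>T\<bar>..\<bar>T\<bar>}" using that by auto
      then show ?thesis by (rule K)
    qed
  qed simp
  then show "fd (\<lambda>w. mul w (axis j T)) 0 y = V (E j T y) (axis j T)"
    by (simp add: u_def w_def)
qed

section \<open>The adjoint matrices of a point and their multiplicativity\<close>

abbreviation coord_product :: "'n list \<Rightarrow> 'n pt \<Rightarrow> 'n pt"
  where "coord_product xs x \<equiv> foldr (\<lambda>j. mul (axis j (x $ j))) xs 0"

lemma right_related_product:
  "right_related (coord_product xs x) (fold (\<lambda>j. E j (x $ j)) xs)"
proof (induction xs)
  case Nil
  show ?case using right_related_0 by simp
next
  case (Cons a xs)
  then show ?case using right_related_mul[OF right_related_axis] by (simp add: o_def)
qed

lemma coord_product_append:
  "coord_product (xs @ ys) x = mul (coord_product xs x) (coord_product ys x)"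
  by (induction xs) (simp_all add: mul_assoc)

text \<open>\<open>N x\<close> and \<open>M x\<close> are the matrices of \<open>Ad(x)\<^sup>-\<^sup>1\<close> and \<open>Ad(x)\<close>.\<close>

definition N :: "'n pt \<Rightarrow> 'n pt \<Rightarrow> 'n pt"
  where "N x = fold (\<lambda>j. E j (x $ j)) (rev (sorted_list_of_set UNIV))"

definition M :: "'n pt \<Rightarrow> 'n pt \<Rightarrow> 'n pt"
  where "M x = fold (\<lambda>j. E j (- (x $ j))) (sorted_list_of_set UNIV)"

lemma linear_M: "linear (M x)"
  unfolding M_def by (intro linear_fold linear_E)

lemma M_N [simp]: "M x (N x y) = y"
proof -
  have "fold (\<lambda>j. E j (- (x $ j))) xs (fold (\<lambda>j. E j (x $ j)) (rev xs) y) = y" for xs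
    by (induction xs) auto
  then show ?thesis by (simp add: M_def N_def)
qed

lemma N_M [simp]: "N x (M x y) = y"
proof -
  have "fold (\<lambda>j. E j (x $ j)) (rev xs) (fold (\<lambda>j. E j (- (x $ j))) xs y) = y" for xs
    by (induction xs arbitrary: y) auto
  then show ?thesis by (simp add: M_def N_def)
qed

lemma M_0 [simp]: "M 0 y = y"
proof -
  have "fold (\<lambda>j. E j 0) xs y = y" for xs :: "'n list" by (induction xs) auto
  then show ?thesis by (simp add: M_def)
qed

lemma N_0 [simp]: "N 0 y = y"
  using M_N[of 0 y] unfolding M_0 .

text \<open>The reversed index list in \<open>N\<close> is the order of the factors in the
  coordinate product, which equals \<open>x\<close>.\<close>

lemma right_related_N: "right_related x (N x)"
  using right_related_product[where xs = "rev (sorted_list_of_set UNIV)" and x = x]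
  unfolding N_def coordinate_product .

text \<open>Both sides belong to right translation by the same product, and the operator of a
  translation is unique.\<close>

lemma N_mul_axis: "N (mul x (axis j t)) y = E j t (N x y)"
  using right_related_unique[OF right_related_N right_related_mul[OF right_related_N right_related_axis]]
  by simp

lemma M_mul_axis: "M (mul x (axis j t)) y = M x (E j (- t) y)"
proof -
  have "N (mul x (axis j t)) (M x (E j (- t) y)) = y" by (simp add: N_mul_axis)
  then show ?thesis by (metis M_N)
qed

section \<open>Derivatives of the adjoint matrices along the basis fields\<close>

text \<open>The factor \<open>c\<close> is \<open>1\<close> for \<open>N\<close> and
  \<open>-1\<close> for \<open>M\<close>; the start value \<open>f x\<close> may vary because each
  step of the induction absorbs one exponential into it.\<close>

lemma differentiable_fold_E:
  fixes f :: "'n pt \<Rightarrow> 'n pt"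
  assumes "f differentiable (at x)"
  shows "(\<lambda>x. fold (\<lambda>j. E j (c * x $ j)) xs (f x)) differentiable (at x)"
  using assms
proof (induction xs arbitrary: f)
  case (Cons a xs)
  have lin: "(\<lambda>x. (B a ^^ k) (f x)) differentiable (at x)" for k
    using differentiable_compose[OF _ Cons.prems] linear_imp_differentiable linear_funpow[OF linear_B] by blast
  have "(\<lambda>x. x $ a) differentiable (at x)"
    by (rule bounded_linear_imp_differentiable[OF bounded_linear_vec_nth])
  then have "(\<lambda>x. E a (c * x $ a) (f x)) differentiable (at x)"
    unfolding nilexp_def divide_inverse by (intro differentiable_sum ballI finite_atMost differentiable_scaleR
        differentiable_mult differentiable_power differentiable_const lin)
  from Cons.IH[OF this] show ?case by simp
qed simp

lemma differentiable_N: "(\<lambda>x. N x y) differentiable (at x)"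
  using differentiable_fold_E[of "\<lambda>_. y" x 1] by (simp add: N_def)

lemma differentiable_M: "(\<lambda>x. M x y) differentiable (at x)"
  using differentiable_fold_E[of "\<lambda>_. y" x "-1"] by (simp add: M_def)

text \<open>The curve \<open>mul x (axis j t)\<close> has velocity \<open>X j x\<close> at
  \<open>t = 0\<close> by left invariance, so the chain rule evaluates the derivative of
  \<open>f\<close> along it.\<close>

lemma fd_along_X:
  assumes "f differentiable (at x)" and "((\<lambda>t. f (mul x (axis j t))) has_vector_derivative D) (at 0)"
  shows "fd f x (X j x) = D"
proof -
  have "((\<lambda>t. mul x (axis j t)) has_derivative (\<lambda>h. fd (mul x) (axis j 0) (h *\<^sub>R axis j 1))) (at 0)"
    by (rule has_derivative_compose[OF has_derivative_axis smooth_has_derivative[OF smooth_mul_left]])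
  moreover have "fd (mul x) (axis j 0) (h *\<^sub>R axis j 1) = h *\<^sub>R X j x" for h
    using left_invariant_0[OF X_in, of j x]
    by (simp add: linear_scale[OF linear_fd[OF smooth_mul_left]] X_0)
  ultimately have d: "((\<lambda>t. mul x (axis j t)) has_derivative (\<lambda>h. h *\<^sub>R X j x)) (at 0)" by simp
  have f: "(f has_derivative fd f x) (at (mul x (axis j 0)))"
    using assms(1) by (simp add: frechet_derivative_works)
  have "((\<lambda>t. f (mul x (axis j t))) has_derivative (\<lambda>h. fd f x (h *\<^sub>R X j x))) (at 0)"
    by (rule has_derivative_compose[OF d f])
  then have "((\<lambda>t. f (mul x (axis j t))) has_vector_derivative fd f x (X j x)) (at 0)"
    unfolding has_vector_derivative_def linear_scale[OF linear_frechet_derivative[OF assms(1)]] .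
  then show ?thesis using assms(2) by (rule vector_derivative_unique_at)
qed

text \<open>By \<open>N_mul_axis\<close>, moving along \<open>X j\<close> multiplies
  \<open>N\<close> by the exponential of \<open>t\<close> times \<open>B j\<close>.\<close>

lemma fd_N: "fd (\<lambda>x. N x y) x (X j x) = B j (N x y)"
proof (rule fd_along_X[OF differentiable_N])
  show "((\<lambda>t. N (mul x (axis j t)) y) has_vector_derivative B j (N x y)) (at 0)"
    unfolding N_mul_axis
    using has_vector_derivative_nilexp[OF linear_B B_nilpotent, of j "N x y" 0] by simp
qed

lemma fd_M: "fd (\<lambda>x. M x y) x (X j x) = - M x (B j y)"
proof (rule fd_along_X[OF differentiable_M])
  have neg: "(uminus has_vector_derivative (-1::real)) (at 0)"
    by (auto intro!: derivative_eq_intros)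
  have "((\<lambda>t. E j (- t) y) has_vector_derivative - B j y) (at 0)"
    using vector_diff_chain_at[OF neg has_vector_derivative_nilexp[OF linear_B B_nilpotent]]
    by (simp add: o_def)
  from bounded_linear.has_vector_derivative[OF linear_conv_bounded_linear[THEN iffD1, OF linear_M] this]
  show "((\<lambda>t. M (mul x (axis j t)) y) has_vector_derivative - M x (B j y)) (at 0)"
    unfolding M_mul_axis by (simp add: linear_neg[OF linear_M])
qed

section \<open>Degree-one components of the basis fields\<close>

text \<open>Every term of positive order in the series contains a bracket and so raises the
  degree.\<close>

lemma E_F:
  assumes y: "y \<in> F m" shows "E j t y - y \<in> F (Suc m)"
proof -
  have "E j t y - y = (\<Sum>k<s. (t ^ Suc k / fact (Suc k)) *\<^sub>R (B j ^^ Suc k) y)"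
    unfolding nilexp_def sum.atMost_shift by simp
  also have "\<dots> \<in> F (Suc m)"
  proof (intro subspace_sum subspace_scale subspace_F)
    fix k
    show "(B j ^^ Suc k) y \<in> F (Suc m)"
      using funpow_B_F[OF y, of "Suc k" j] F_mono[of "Suc m" "m + Suc k"] by auto
  qed
  finally show ?thesis .
qed

lemma fold_E_F:
  assumes y: "y \<in> F m" shows "fold (\<lambda>j. E j (c j)) xs y - y \<in> F (Suc m)"
  using y
proof (induction xs arbitrary: y)
  case Nil
  then show ?case using subspace_0[OF subspace_F] by simp
next
  case (Cons a xs)
  have 1: "E a (c a) y - y \<in> F (Suc m)" by (rule E_F[OF Cons.prems])
  then have "E a (c a) y - y \<in> F m" using F_mono[of m "Suc m"] by auto
  from subspace_add[OF subspace_F this Cons.prems] have "E a (c a) y \<in> F m" by simp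
  from subspace_add[OF subspace_F Cons.IH[OF this] 1] show ?case by simp
qed

text \<open>Differentiate \<open>x = exp (x\<^sub>n X\<^sub>n) \<cdot> \<dots> \<cdot> exp (x\<^sub>1 X\<^sub>1)\<close> along the \<open>j\<close>-th coordinate line.\<close>

lemma axis_eq_V: "\<exists>w \<in> F (Suc (d j)). axis j 1 = X j x + V w x"
proof -
  have "j \<in> set (rev (sorted_list_of_set (UNIV :: 'n set)))" by simp
  then obtain xs ys where split: "rev (sorted_list_of_set (UNIV :: 'n set)) = xs @ j # ys"
    by (meson split_list)
  have "distinct (rev (sorted_list_of_set (UNIV :: 'n set)))" by simp
  then have nin: "j \<notin> set xs" "j \<notin> set ys" unfolding split by auto
  define T where "T = fold (\<lambda>i. E i (x $ i)) ys"
  let ?P = "coord_product xs x" and ?Q = "coord_product ys x"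
  let ?a = "axis j (x $ j)"
  \<comment> \<open>The \<open>j\<close>-th coordinate line through \<open>x\<close>, parametrised
    by the coordinate itself. In its product representation the \<open>j\<close>-th factor alone
    moves.\<close>
  define \<phi> where "\<phi> = (\<lambda>t. x + (t - x $ j) *\<^sub>R axis j 1)"
  have eq: "\<phi> t = mul ?P (mul (axis j t) ?Q)" for t
  proof -
    have "coord_product zs (\<phi> t) = coord_product zs x" if "j \<notin> set zs" for zs
      using that by (intro foldr_cong) (auto simp: \<phi>_def axis_def cong: if_cong)
    moreover have "\<phi> t $ j = t" by (simp add: \<phi>_def)
    ultimately show ?thesis
      using coordinate_product[of "\<phi> t"] nin unfolding split coord_product_append by simp
  qed
  have r: "((\<lambda>w. mul w ?Q) has_derivative fd (\<lambda>w. mul w ?Q) ?a) (at ?a)"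
    by (rule smooth_has_derivative[OF smooth_mul_right])
  have l: "(mul ?P has_derivative fd (mul ?P) (mul ?a ?Q)) (at (mul ?a ?Q))"
    by (rule smooth_has_derivative[OF smooth_mul_left])
  have "((\<lambda>t. mul ?P (mul (axis j t) ?Q)) has_derivative
      (\<lambda>h. fd (mul ?P) (mul ?a ?Q) (fd (\<lambda>w. mul w ?Q) ?a (h *\<^sub>R axis j 1)))) (at (x $ j))"
    by (rule has_derivative_compose[OF has_derivative_compose[OF has_derivative_axis r] l])
  moreover have "(\<phi> has_derivative (\<lambda>h. h *\<^sub>R axis j 1)) (at (x $ j))"
    unfolding \<phi>_def by (auto intro!: derivative_eq_intros)
  ultimately have "(\<lambda>h. fd (mul ?P) (mul ?a ?Q) (fd (\<lambda>w. mul w ?Q) ?a (h *\<^sub>R axis j 1))) =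
      (\<lambda>h. h *\<^sub>R axis j 1)"
    unfolding eq[abs_def] by (rule has_derivative_unique)
  from fun_cong[OF this, of 1]
  have "axis j 1 = fd (mul ?P) (mul ?a ?Q) (fd (\<lambda>w. mul w ?Q) ?a (V (axis j 1) ?a))"
    by (simp add: X_axis)
  \<comment> \<open>Right translation by \<open>?Q\<close> turns \<open>X j\<close> into
    \<open>V (T (axis j 1))\<close>; the following left translation leaves this field
    invariant.\<close>
  also have "\<dots> = fd (mul ?P) (mul ?a ?Q) (V (T (axis j 1)) (mul ?a ?Q))"
    using right_related_product[where xs = ys and x = x, unfolded right_related_def,
        THEN spec, THEN spec, of ?a "axis j 1"] unfolding T_def by (rule arg_cong)
  also have "\<dots> = V (T (axis j 1)) (mul ?P (mul ?a ?Q))"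
    by (rule left_invariant_V[symmetric])
  also have "mul ?P (mul ?a ?Q) = x" using eq[of "x $ j"] by (simp add: \<phi>_def)
  also have "V (T (axis j 1)) x = X j x + V (T (axis j 1) - axis j 1) x"
    using linear_diff[OF linear_V_apply, of "T (axis j 1)" "axis j 1" x] by simp
  finally have "axis j 1 = X j x + V (T (axis j 1) - axis j 1) x" .
  moreover have "T (axis j 1) - axis j 1 \<in> F (Suc (d j))"
    unfolding T_def by (rule fold_E_F) (auto simp: F_def axis_def)
  ultimately show ?thesis by blast
qed

text \<open>Descending induction on the degree, starting at \<open>s + 1\<close>, which no index
  has: by \<open>axis_eq_V\<close>, \<open>X k\<close> is the \<open>k\<close>-th coordinate field
  minus fields of higher degree, and \<open>k\<close> differs from \<open>i\<close>.\<close>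

lemma X_component_higher:
  assumes "d i = 1" and "2 \<le> d k" shows "X k x $ i = 0"
proof -
  have V0: "V w x $ i = 0" if "\<And>k. m \<le> d k \<Longrightarrow> X k x $ i = 0" "w \<in> F m" for w m
    unfolding V_apply sum_component using that by (intro sum.neutral) (auto simp: F_def)
  have "2 \<le> Suc s" using deg(1)[of i] by auto
  then have "\<forall>k. 2 \<le> d k \<longrightarrow> X k x $ i = 0"
  proof (induction rule: inc_induct)
    case base
    then show ?case using deg(1) by (metis Suc_n_not_le_n atLeastAtMost_iff le_trans)
  next
    case (step n)
    show ?case
    proof (intro allI impI)
      fix k assume k: "n \<le> d k"
      obtain w where w: "w \<in> F (Suc (d k))" "axis k 1 = X k x + V w x" using axis_eq_V by blast
      have "w \<in> F (Suc n)" using w(1) k F_mono[of "Suc n" "Suc (d k)"] by auto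
      then have "V w x $ i = 0" using step.IH V0 by blast
      moreover have "i \<noteq> k" using assms(1) k step.hyps by auto
      ultimately show "X k x $ i = 0"
        using arg_cong[OF w(2), of "\<lambda>v. v $ i"] by (simp add: axis_def)
    qed
  qed
  then show ?thesis using assms by blast
qed

text \<open>The correction terms in \<open>axis_eq_V\<close> have degree at least two, so their
  \<open>i\<close>-th components vanish. This lets the control of a horizontal curve be read off
  from its velocity.\<close>

lemma X_component:
  assumes "d i = 1" and "d k = 1" shows "X k x $ i = (if k = i then 1 else 0)"
proof -
  obtain w where w: "w \<in> F (Suc (d k))" "axis k 1 = X k x + V w x" using axis_eq_V by blast
  have "V w x $ i = 0"
    unfolding V_apply sum_component using w(1) X_component_higher[OF assms(1)] assms(2)
    by (intro sum.neutral) (auto simp: F_def)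
  then show ?thesis using arg_cong[OF w(2), of "\<lambda>v. v $ i"] by (auto simp: axis_def)
qed

section \<open>The rank and the indices of degree one\<close>

text \<open>By \<open>g_coeff\<close>, elements of \<open>g 1\<close> involve basis fields of degree
  one alone, so these fields form a basis of \<open>g 1\<close>.\<close>

lemma dim_g1: "dim (g 1) = card {j. d j = 1}"
proof -
  let ?S = "{j. d j = 1}"
  have "g 1 \<subseteq> span (X ` ?S)"
  proof
    fix Y assume Y: "Y \<in> g 1"
    have s1: "1 \<le> s" using deg(1) by fastforce
    obtain y where y: "Y = V y" using lie_algebra_V Y g_sub[of 1] by blast
    have "(y $ k) *\<^sub>R X k \<in> span (X ` ?S)" for k
    proof (cases "y $ k = 0")
      case False
      then have "d k = 1" using g_coeff[OF _ s1, of y k] Y y by simp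
      then show ?thesis by (intro span_scale span_base) auto
    qed (simp add: span_zero)
    then show "Y \<in> span (X ` ?S)" unfolding y V_def by (intro span_sum)
  qed
  moreover have "span (X ` ?S) \<subseteq> g 1"
    using deg(2) by (intro span_minimal subspace_g) (auto, metis)
  ultimately have "dim (g 1) = dim (X ` ?S)" by (metis dim_span subset_antisym)
  also have "\<dots> = card (X ` ?S)"
    by (rule dim_eq_card_independent) (rule independent_mono[OF indep_X], blast)
  also have "\<dots> = card ?S" using inj_X by (intro card_image) (auto intro: inj_on_subset)
  finally show ?thesis .
qed

text \<open>Degrees are weakly increasing, so the indices of degree one form an initial segment,
  whose length is the rank.\<close>

lemma first_indices_eq: "first_indices (dim (g 1)) = {j. d j = 1}"
proof -
  let ?S = "{j. d j = 1}"
  have "card {..j} \<le> card ?S" if "d j = 1" for j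
  proof (rule card_mono)
    show "{..j} \<subseteq> ?S"
    proof
      fix i assume "i \<in> {..j}"
      then have "d i \<le> d j" using deg(3)[of i j] by (cases "i = j") auto
      then show "i \<in> ?S" using that deg(1)[of i] by auto
    qed
  qed simp
  moreover have "card ?S < card {..j}" if "d j \<noteq> 1" for j
  proof (rule psubset_card_mono)
    have "i < j" if "d i = 1" for i
      using that \<open>d j \<noteq> 1\<close> deg(1)[of j] deg(3)[of j i] by (metis antisym atLeastAtMost_iff not_less_iff_gr_or_eq)
    then show "?S \<subset> {..j}" using that by fastforce
  qed simp
  ultimately show ?thesis unfolding first_indices_def dim_g1 by (auto simp: not_le[symmetric])
qed

section \<open>Extremal polynomials as entries of the adjoint matrix\<close>

text \<open>The sign is absorbed by replacing \<open>x\<close> with its negative, nilpotency cuts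
  the sum down to exponents at most \<open>s\<close>, and the finite sum is the expansion of the
  product of exponentials.\<close>

lemma extremal_poly_M: "extremal_poly X v i x = v \<bullet> M x (axis i 1)"
proof -
  let ?l = "sorted_list_of_set (UNIV :: 'n set)"
  let ?P = "Pi\<^sub>E UNIV (\<lambda>_. {..s}) :: ('n \<Rightarrow> nat) set"
  define G where "G = (\<lambda>\<alpha>. fold (\<lambda>j. B j ^^ \<alpha> j) ?l (axis i 1))"
  \<comment> \<open>An exponent above \<open>s\<close> at one index already gives zero, and the
    later linear factors keep it.\<close>
  have G0: "G \<alpha> = 0" if "\<alpha> \<notin> ?P" for \<alpha>
  proof -
    have "\<not> (\<forall>j. \<alpha> j \<le> s)" using that by (auto simp: PiE_UNIV_domain)
    then obtain j where j: "Suc s \<le> \<alpha> j" using not_less_eq_eq by blast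
    have "(B j ^^ \<alpha> j) y = 0" for y
    proof -
      have "(B j ^^ \<alpha> j) y = (B j ^^ Suc s) ((B j ^^ (\<alpha> j - Suc s)) y)"
        using j by (metis comp_apply funpow_add le_add_diff_inverse)
      then show ?thesis using B_nilpotent by simp
    qed
    moreover obtain xs ys where "?l = xs @ j # ys"
      using split_list[of j ?l] by auto
    moreover have "fold (\<lambda>j. B j ^^ \<alpha> j) ys 0 = 0" for ys
      by (rule linear_0[OF linear_fold[OF linear_funpow[OF linear_B]]])
    ultimately show ?thesis by (simp add: G_def)
  qed
  have "extremal_poly X v i x = (\<Sum>\<^sub>\<infinity>\<alpha>\<in>UNIV. (\<Prod>j\<in>UNIV. (- (x $ j)) ^ \<alpha> j / fact (\<alpha> j)) * (v \<bullet> G \<alpha>))"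
    unfolding extremal_poly_def gen_struct_const_fold
  proof (rule infsum_cong)
    fix \<alpha> :: "'n \<Rightarrow> nat"
    have "(\<Prod>j\<in>UNIV. (- (x $ j)) ^ \<alpha> j / fact (\<alpha> j)) =
      (\<Prod>j\<in>UNIV. (- 1) ^ \<alpha> j * ((x $ j) ^ \<alpha> j)) / (\<Prod>j\<in>UNIV. fact (\<alpha> j))"
      by (simp add: prod_dividef power_minus[of "_ $ _"])
    also have "\<dots> = (- 1) ^ (\<Sum>j\<in>UNIV. \<alpha> j) / (\<Prod>j\<in>UNIV. fact (\<alpha> j)) * (\<Prod>j\<in>UNIV. (x $ j) ^ \<alpha> j)"
      by (simp add: prod.distrib power_sum)
    finally show "(- 1) ^ (\<Sum>j\<in>UNIV. \<alpha> j) / (\<Prod>j\<in>UNIV. fact (\<alpha> j)) *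
        (\<Sum>k\<in>UNIV. fold (\<lambda>j. B j ^^ \<alpha> j) ?l (axis i 1) $ k * v $ k) * (\<Prod>j\<in>UNIV. (x $ j) ^ \<alpha> j) =
        (\<Prod>j\<in>UNIV. (- (x $ j)) ^ \<alpha> j / fact (\<alpha> j)) * (v \<bullet> G \<alpha>)"
      by (simp add: G_def inner_vec_def mult.commute mult.left_commute)
  qed
  also have "\<dots> = (\<Sum>\<^sub>\<infinity>\<alpha>\<in>?P. (\<Prod>j\<in>UNIV. (- (x $ j)) ^ \<alpha> j / fact (\<alpha> j)) * (v \<bullet> G \<alpha>))"
    by (rule infsum_cong_neutral) (auto simp: G0)
  also have "\<dots> = (\<Sum>\<alpha>\<in>?P. (\<Prod>j\<in>UNIV. (- (x $ j)) ^ \<alpha> j / fact (\<alpha> j)) * (v \<bullet> G \<alpha>))"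
    by (rule infsum_finite) (simp add: finite_PiE)
  also have "\<dots> = v \<bullet> (\<Sum>\<alpha>\<in>?P. (\<Prod>j\<in>UNIV. (- (x $ j)) ^ \<alpha> j / fact (\<alpha> j)) *\<^sub>R G \<alpha>)"
    by (simp add: inner_sum_right)
  also have "(\<Sum>\<alpha>\<in>?P. (\<Prod>j\<in>UNIV. (- (x $ j)) ^ \<alpha> j / fact (\<alpha> j)) *\<^sub>R G \<alpha>) = M x (axis i 1)"
    using fold_nilexp_expand[OF linear_B, where xs = ?l and n = s and x = "\<lambda>j. - (x $ j)"
        and y = "axis i 1"]
    by (simp add: M_def G_def)
  finally show ?thesis .
qed

subsection \<open>Horizontal curves and the adjoint equation\<close>

lemma fd_linear_combination:
  assumes "f differentiable (at x)"
  shows "fd f x (\<Sum>j\<in>I. c j *\<^sub>R X j x) = (\<Sum>j\<in>I. c j *\<^sub>R fd f x (X j x))"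
  using linear_frechet_derivative[OF assms] by (simp add: linear_sum linear_scale)

text \<open>The control \<open>h\<close> is replaced by the components of the velocity, which is the
  form in which it enters the equation. For an index \<open>i\<close> of degree one,
  \<open>X_component\<close> shows that the \<open>i\<close>-th component of the velocity is
  \<open>h i t\<close>.\<close>

lemma horizontal_velocity:
  assumes "horizontal_curve X (dim (g 1)) \<gamma>"
  shows "AE t in lebesgue_on {0..1}. (\<gamma> has_vector_derivative
    (\<Sum>j\<in>first_indices (dim (g 1)). (vector_derivative \<gamma> (at t within {0..1}) $ j) *\<^sub>R X j (\<gamma> t)))
    (at t within {0..1})"
proof -
  let ?I = "first_indices (dim (g 1)) :: 'n set"
  obtain h where h: "AE t in lebesgue_on {0..1}.
      (\<gamma> has_vector_derivative (\<Sum>j\<in>?I. h j t *\<^sub>R X j (\<gamma> t))) (at t within {0..1})"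
    using assms unfolding horizontal_curve_def by blast
  have "AE t in lebesgue_on {0..1}. t \<in> {0..1::real}" by (rule AE_I2) simp
  with h show ?thesis
  proof eventually_elim
    case (elim t)
    have D: "vector_derivative \<gamma> (at t within {0..1}) = (\<Sum>j\<in>?I. h j t *\<^sub>R X j (\<gamma> t))"
      using vector_derivative_within_cbox[of 0 1 t \<gamma>] elim by simp
    have mem: "i \<in> ?I \<longleftrightarrow> d i = 1" for i by (simp only: first_indices_eq mem_Collect_eq)
    have c: "vector_derivative \<gamma> (at t within {0..1}) $ i = h i t" if i: "i \<in> ?I" for i
    proof -
      have "(\<Sum>j\<in>?I. h j t *\<^sub>R X j (\<gamma> t)) $ i = (\<Sum>j\<in>?I. if j = i then h j t else 0)"
        unfolding sum_component
      proof (rule sum.cong[OF refl])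
        fix j assume "j \<in> ?I"
        then show "(h j t *\<^sub>R X j (\<gamma> t)) $ i = (if j = i then h j t else 0)"
          using X_component[of i j "\<gamma> t"] i unfolding mem by simp
      qed
      then show ?thesis using i D by simp
    qed
    have "(\<Sum>j\<in>?I. (vector_derivative \<gamma> (at t within {0..1}) $ j) *\<^sub>R X j (\<gamma> t)) =
        (\<Sum>j\<in>?I. h j t *\<^sub>R X j (\<gamma> t))"
      by (rule sum.cong[OF refl]) (simp only: c)
    then show ?case using elim(1) by simp
  qed
qed

text \<open>Provides the Lipschitz hypothesis of the constancy criterion for functions built from
  \<open>N\<close> along the curve.\<close>

lemma lipschitz01_fold_E:
  assumes "lipschitz01 \<gamma>" "lipschitz01 f"
  shows "lipschitz01 (\<lambda>t. fold (\<lambda>j. E j (\<gamma> t $ j)) xs (f t))"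
  using assms(2)
proof (induction xs arbitrary: f)
  case (Cons a xs)
  have c: "lipschitz01 (\<lambda>t. \<gamma> t $ a)"
    by (rule lipschitz01_linear[OF bounded_linear_vec_nth assms(1)])
  have pow: "lipschitz01 (\<lambda>t. (\<gamma> t $ a) ^ k)" for k
  proof (induction k)
    case (Suc k)
    show ?case using lipschitz01_scaleR[OF c Suc.IH] by simp
  qed (simp add: lipschitz01_const)
  have p: "lipschitz01 (\<lambda>t. (\<gamma> t $ a) ^ k / fact k)" for k
    using lipschitz01_scaleR[OF pow[of k] lipschitz01_const[of "inverse (fact k) :: real"]]
    by (simp add: divide_inverse)
  have l: "lipschitz01 (\<lambda>t. (B a ^^ k) (f t))" for k
    by (rule lipschitz01_linear[OF linear_conv_bounded_linear[THEN iffD1, OF linear_funpow[OF linear_B]]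
          Cons.prems])
  have "lipschitz01 (\<lambda>t. E a (\<gamma> t $ a) (f t))"
    unfolding nilexp_def by (intro lipschitz01_sum lipschitz01_scaleR p l)
  from Cons.IH[OF this] show ?case by simp
qed simp

lemma has_vector_derivative_along:
  assumes "\<And>x. f differentiable (at x)"
    and "(\<gamma> has_vector_derivative (\<Sum>j\<in>I. c j *\<^sub>R X j (\<gamma> t))) (at t within S)"
  shows "((\<lambda>t. f (\<gamma> t)) has_vector_derivative (\<Sum>j\<in>I. c j *\<^sub>R fd f (\<gamma> t) (X j (\<gamma> t)))) (at t within S)"
proof -
  have f: "(f has_derivative fd f x) (at x)" for x
    using assms(1) by (simp add: frechet_derivative_works)
  from has_derivative_compose[OF assms(2)[unfolded has_vector_derivative_def] f]
  show ?thesis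
    unfolding has_vector_derivative_def
    by (simp add: linear_scale[OF linear_frechet_derivative[OF assms(1)]] fd_linear_combination[OF assms(1)])
qed

section \<open>The adjoint equation along a horizontal curve\<close>

text \<open>The structure constants are the components of \<open>B j\<close> on the coordinate
  vectors, so the right-hand side is a pairing with the bracket against the horizontal
  velocity.\<close>

lemma adjoint_rhs:
  "- (\<Sum>k\<in>UNIV. \<Sum>j\<in>I. struct_const X i j k * c j * l k) =
    - ((\<chi> k. l k) \<bullet> (\<Sum>j\<in>I. c j *\<^sub>R B j (axis i 1)))"
  unfolding struct_const_br B_def inner_vec_def
  by (simp add: sum_distrib_left mult.commute mult.left_commute)

lemma adjoint_equation_iff:
  fixes \<gamma> :: "real \<Rightarrow> 'n pt" and lam :: "'n \<Rightarrow> real \<Rightarrow> real"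
  assumes hor: "horizontal_curve X (dim (g 1)) \<gamma>" and \<gamma>0: "\<gamma> 0 = 0"
    and lip: "\<And>i. lipschitz01 (lam i)"
  shows "(\<forall>i. AE t in lebesgue_on {0..1}.
            (lam i has_real_derivative
              - (\<Sum>k\<in>UNIV. \<Sum>j\<in>first_indices (dim (g 1)).
                  struct_const X i j k * (vector_derivative \<gamma> (at t within {0..1}) $ j) * lam k t))
              (at t within {0..1}))
     \<longleftrightarrow> (\<exists>v. \<forall>i. \<forall>t\<in>{0..1}. lam i t = extremal_poly X v i (\<gamma> t))" (is "?A \<longleftrightarrow> ?B")
proof
  let ?I = "first_indices (dim (g 1)) :: 'n set"
  let ?c = "\<lambda>t j. vector_derivative \<gamma> (at t within {0..1}) $ j"
  \<comment> \<open>With \<open>W t\<close>, the curves \<open>N (\<gamma> t) y\<close> and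
    \<open>M (\<gamma> t) y\<close> have derivatives \<open>W t (N (\<gamma> t) y)\<close> and
    \<open>- M (\<gamma> t) (W t y)\<close> almost everywhere.\<close>
  define W where "W = (\<lambda>t y. \<Sum>j\<in>?I. ?c t j *\<^sub>R B j y)"
  define \<Lambda> where "\<Lambda> = (\<lambda>t. \<chi> k. lam k t)"
  have linW: "linear (W t)" for t
    unfolding W_def by (intro linear_compose_sum ballI linear_compose_scale_right linear_B)
  have rhs: "- (\<Sum>k\<in>UNIV. \<Sum>j\<in>?I. struct_const X i j k * ?c t j * lam k t) = - (\<Lambda> t \<bullet> W t (axis i 1))" for i t
    unfolding adjoint_rhs W_def \<Lambda>_def ..
  have ivl: "AE t in lebesgue_on {0..1}. t \<in> {0..1::real}" by (rule AE_I2) simp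
  note vel = horizontal_velocity[OF hor]
  {
    assume ?A
    then have all: "AE t in lebesgue_on {0..1}. \<forall>i.
        (lam i has_real_derivative - (\<Lambda> t \<bullet> W t (axis i 1))) (at t within {0..1})"
      unfolding rhs by (simp add: AE_all_countable)
    have const: "\<Lambda> t \<bullet> N (\<gamma> t) z = \<Lambda> 0 \<bullet> z" if t: "t \<in> {0..1}" for t z
    proof -
      define f where "f = (\<lambda>t. \<Lambda> t \<bullet> N (\<gamma> t) z)"
      have feq: "f = (\<lambda>t. \<Sum>i\<in>UNIV. lam i t *\<^sub>R (N (\<gamma> t) z $ i))"
        by (simp add: f_def \<Lambda>_def inner_vec_def fun_eq_iff)
      have "lipschitz01 \<gamma>" using hor by (simp add: horizontal_curve_def)
      then have "lipschitz01 (\<lambda>t. N (\<gamma> t) z)"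
        unfolding N_def by (rule lipschitz01_fold_E) (rule lipschitz01_const)
      then have "lipschitz01 f"
        unfolding feq
        by (intro lipschitz01_sum lipschitz01_scaleR lip lipschitz01_linear[OF bounded_linear_vec_nth])
      then obtain L where L: "L-lipschitz_on {0..1} f" by (auto simp: lipschitz01_def)
      have "AE t in lebesgue_on {0..1}. (f has_real_derivative 0) (at t within {0..1})"
        using all vel
      proof eventually_elim
        case (elim t)
        have N': "((\<lambda>t. N (\<gamma> t) z) has_derivative (\<lambda>h. h *\<^sub>R W t (N (\<gamma> t) z))) (at t within {0..1})"
          using has_vector_derivative_along[OF differentiable_N elim(2), of z]
          unfolding has_vector_derivative_def W_def fd_N .
        have "(f has_derivative (\<lambda>h. \<Sum>i\<in>UNIV. lam i t *\<^sub>R ((h *\<^sub>R W t (N (\<gamma> t) z)) $ i)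
            + (- (\<Lambda> t \<bullet> W t (axis i 1)) * h) *\<^sub>R (N (\<gamma> t) z $ i))) (at t within {0..1})"
          unfolding feq
          by (intro has_derivative_sum has_derivative_scaleR
              bounded_linear.has_derivative[OF bounded_linear_vec_nth N']
              elim(1)[rule_format, unfolded has_field_derivative_def])
        \<comment> \<open>Expanding \<open>W t\<close> on the coordinate vectors shows that the two
          halves of the product rule are opposite.\<close>
        moreover have "(\<Sum>i\<in>UNIV. lam i t *\<^sub>R ((h *\<^sub>R W t (N (\<gamma> t) z)) $ i)
            + (- (\<Lambda> t \<bullet> W t (axis i 1)) * h) *\<^sub>R (N (\<gamma> t) z $ i)) = 0" for h
        proof -
          have W: "W t y = (\<Sum>i\<in>UNIV. (y $ i) *\<^sub>R W t (axis i 1))" for y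
            by (subst (1) sum_axis[of y, symmetric])
              (simp add: linear_sum[OF linW] linear_scale[OF linW])
          have "(\<Sum>i\<in>UNIV. lam i t *\<^sub>R ((h *\<^sub>R W t (N (\<gamma> t) z)) $ i)) = h * (\<Lambda> t \<bullet> W t (N (\<gamma> t) z))"
            by (simp add: \<Lambda>_def inner_vec_def sum_distrib_left mult.left_commute)
          moreover have "(\<Sum>i\<in>UNIV. (- (\<Lambda> t \<bullet> W t (axis i 1)) * h) *\<^sub>R (N (\<gamma> t) z $ i))
              = - h * (\<Lambda> t \<bullet> (\<Sum>i\<in>UNIV. (N (\<gamma> t) z $ i) *\<^sub>R W t (axis i 1)))"
            by (simp add: inner_sum_right sum_distrib_left sum_negf mult.commute mult.left_commute)
          ultimately show ?thesis unfolding sum.distrib W[symmetric] by simp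
        qed
        ultimately show ?case by (simp add: has_field_derivative_def lambda_zero)
      qed
      from lipschitz_ae_zero_derivative_constant[OF L this t] show ?thesis
        by (simp add: f_def \<gamma>0)
    qed
    \<comment> \<open>Constancy holds for every fixed \<open>z\<close>, so at each time
      \<open>z\<close> may be chosen as \<open>M (\<gamma> t) (axis i 1)\<close>, which
      \<open>N (\<gamma> t)\<close> sends back to \<open>axis i 1\<close>.\<close>
    have "lam i t = extremal_poly X (\<Lambda> 0) i (\<gamma> t)" if "t \<in> {0..1}" for i t
      using const[OF that, of "M (\<gamma> t) (axis i 1)"]
      by (simp add: extremal_poly_M inner_axis) (simp add: \<Lambda>_def)
    then show ?B by blast
  }
  {
    assume ?B
    then obtain v where v: "\<And>i t. t \<in> {0..1} \<Longrightarrow> lam i t = v \<bullet> M (\<gamma> t) (axis i 1)"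
      unfolding extremal_poly_M by blast
    show ?A
      unfolding rhs
    proof
      fix i
      show "AE t in lebesgue_on {0..1}.
          (lam i has_real_derivative - (\<Lambda> t \<bullet> W t (axis i 1))) (at t within {0..1})"
        using vel ivl
      proof eventually_elim
        case (elim t)
        have "((\<lambda>t. M (\<gamma> t) (axis i 1)) has_vector_derivative - M (\<gamma> t) (W t (axis i 1)))
            (at t within {0..1})"
          using has_vector_derivative_along[OF differentiable_M elim(1), of "axis i 1"]
          by (simp add: fd_M W_def linear_sum[OF linear_M] linear_scale[OF linear_M] sum_negf)
        from bounded_linear.has_vector_derivative[OF bounded_linear_inner_right this, of v]
        have "((\<lambda>t. v \<bullet> M (\<gamma> t) (axis i 1)) has_real_derivative - (v \<bullet> M (\<gamma> t) (W t (axis i 1))))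
            (at t within {0..1})"
          by (simp add: has_real_derivative_iff_has_vector_derivative)
        \<comment> \<open>By linearity, the values on the coordinate vectors, which are the
          \<open>lam k t\<close>, determine the pairing on all vectors.\<close>
        moreover have "v \<bullet> M (\<gamma> t) (W t (axis i 1)) = \<Lambda> t \<bullet> W t (axis i 1)"
        proof -
          have m: "M (\<gamma> t) y = (\<Sum>k\<in>UNIV. (y $ k) *\<^sub>R M (\<gamma> t) (axis k 1))" for y
            by (subst (1) sum_axis[of y, symmetric])
              (simp add: linear_sum[OF linear_M] linear_scale[OF linear_M])
          have "v \<bullet> M (\<gamma> t) y = (\<Sum>k\<in>UNIV. y $ k * lam k t)" for y
            by (subst m) (simp add: inner_sum_right v[OF elim(2)])
          then show ?thesis by (simp add: \<Lambda>_def inner_vec_def mult.commute)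
        qed
        ultimately have "((\<lambda>t. v \<bullet> M (\<gamma> t) (axis i 1)) has_real_derivative - (\<Lambda> t \<bullet> W t (axis i 1)))
            (at t within {0..1})" by simp
        then show ?case
          by (rule has_field_derivative_transform_within[OF _ zero_less_one elim(2)]) (simp add: v)
      qed
    qed
  }
qed

end

theorem theorem3p4:
  fixes mul :: "'n::{finite,linorder} pt \<Rightarrow> 'n pt \<Rightarrow> 'n pt"
    and iv :: "'n pt \<Rightarrow> 'n pt"
    and s r :: nat
    and g :: "nat \<Rightarrow> 'n vfield set"
    and X :: "'n \<Rightarrow> 'n vfield"
    and \<gamma> :: "real \<Rightarrow> 'n pt"
    and lam :: "'n \<Rightarrow> real \<Rightarrow> real"
  assumes "lie_group mul iv"
    and "stratification mul s g"
    and "r = dim (g 1)"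
    and "adapted_basis mul s g X"
    and "second_type_coordinates mul X"
    and "horizontal_curve X r \<gamma>"
    and "\<gamma> 0 = 0"
    and "\<And>i. lipschitz01 (lam i)"
  shows "((\<forall>i. AE t in lebesgue_on {0..1}.
            (lam i has_real_derivative
              - (\<Sum>k\<in>UNIV. \<Sum>j\<in>first_indices r.
                  struct_const X i j k * (vector_derivative \<gamma> (at t within {0..1}) $ j) * lam k t))
              (at t within {0..1}))
          \<longleftrightarrow> (\<exists>v. \<forall>i. \<forall>t\<in>{0..1}. lam i t = extremal_poly X v i (\<gamma> t)))
      \<and> (\<forall>v. (\<forall>i. \<forall>t\<in>{0..1}. lam i t = extremal_poly X v i (\<gamma> t)) \<longrightarrow> v = (\<chi> i. lam i 0))"
proof -
  obtain d where "\<And>j. d j \<in> {1..s}" "\<And>j. X j \<in> g (d j)" "\<And>i j. i < j \<Longrightarrow> d i \<le> d j"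
    using assms(4) unfolding adapted_basis_def by blast
  then interpret stratified_coordinates mul iv s g X d
    using assms(1,2,4,5) by unfold_locales (auto simp: adapted_basis_def)
  \<comment> \<open>At time \<open>0\<close> the curve is at the origin, where \<open>M\<close> is
    the identity, so the \<open>i\<close>-th polynomial takes the value
    \<open>v $ i\<close>.\<close>
  have "v = (\<chi> i. lam i 0)"
    if v: "\<forall>i. \<forall>t\<in>{0..1}. lam i t = extremal_poly X v i (\<gamma> t)" for v
  proof -
    have "lam i 0 = v $ i" for i
      using v[rule_format, of 0 i] by (simp add: extremal_poly_M assms(7) inner_axis)
    then show ?thesis by (simp add: vec_eq_iff)
  qed
  then show ?thesis
    using adjoint_equation_iff[of \<gamma> lam, OF assms(6)[unfolded assms(3)] assms(7,8)] unfolding assms(3) by blast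
qed

end
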